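(* There exists a deterministic linear-time algorithm that, given as input (i) a bipartite Pfaffian graph $G$ with minimum degree at least three, (ii) a Hamiltonian cycle $H$ in $G$, and (iii) an edge $e\in E(H)$, outputs a Hamiltonian cycle $H'\neq H$ in $G$ with $e\in E(H')$.
   Context: All graphs are finite, undirected, simple and loopless. An orientation $\vec G$ of a graph $G$ replaces each edge $\{u,v\}$ by exactly one of the arcs $(u,v)$, $(v,u)$. A cycle $C$ of $G$ is central if $G\setminus V(C)$ has a perfect matching. An orientation of a cycle is consistent if it is a directed cycle (strongly connected). An orientation $\vec G$ of $G$ is Pfaffian if for every central cycle $C$ of $G$, each of the two consistent orientations of $C$ has an odd number of arcs in common with $\vec G$. A graph is Pfaffian if it admits a Pfaffian orientation. *)

theory Defs
  imports Main
begin

section \<open>Graphs\<close>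

text \<open>A graph is a vertex set together with a set of two-element vertex sets.\<close>

definition simple_graph :: "'a set \<Rightarrow> 'a set set \<Rightarrow> bool" where
  "simple_graph V E \<longleftrightarrow>
     finite V \<and> (\<forall>e\<in>E. \<exists>u v. u \<in> V \<and> v \<in> V \<and> u \<noteq> v \<and> e = {u, v})"

definition bipartite :: "'a set \<Rightarrow> 'a set set \<Rightarrow> bool" where
  "bipartite V E \<longleftrightarrow>
     (\<exists>X Y. X \<union> Y = V \<and> X \<inter> Y = {} \<and> (\<forall>e\<in>E. \<exists>x\<in>X. \<exists>y\<in>Y. e = {x, y}))"

definition degree :: "'a set set \<Rightarrow> 'a \<Rightarrow> nat" where
  "degree E v = card {e \<in> E. v \<in> e}"

definition has_perfect_matching :: "'a set \<Rightarrow> 'a set set \<Rightarrow> bool" where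
  "has_perfect_matching V E \<longleftrightarrow> (\<exists>M. M \<subseteq> E \<and> (\<forall>v\<in>V. \<exists>!e. e \<in> M \<and> v \<in> e))"

definition induced_edges :: "'a set set \<Rightarrow> 'a set \<Rightarrow> 'a set set" where
  "induced_edges E W = {e \<in> E. e \<subseteq> W}"

text \<open>
  A cycle is given by a list of its vertices in one of its traversal orders.  Several lists
  (rotations and reversals) describe the same cycle; two lists describe the same cycle
  iff their edge sets agree.
\<close>

definition cycle_arcs :: "'a list \<Rightarrow> ('a \<times> 'a) set" where
  "cycle_arcs vs = {(vs ! i, vs ! (Suc i mod length vs)) | i. i < length vs}"

definition cycle_edges :: "'a list \<Rightarrow> 'a set set" where
  "cycle_edges vs = {{u, v} | u v. (u, v) \<in> cycle_arcs vs}"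

definition is_cycle :: "'a set \<Rightarrow> 'a set set \<Rightarrow> 'a list \<Rightarrow> bool" where
  "is_cycle V E vs \<longleftrightarrow>
     3 \<le> length vs \<and> distinct vs \<and> set vs \<subseteq> V \<and> cycle_edges vs \<subseteq> E"

definition hamiltonian_cycle :: "'a set \<Rightarrow> 'a set set \<Rightarrow> 'a list \<Rightarrow> bool" where
  "hamiltonian_cycle V E vs \<longleftrightarrow> is_cycle V E vs \<and> set vs = V"

definition central_cycle :: "'a set \<Rightarrow> 'a set set \<Rightarrow> 'a list \<Rightarrow> bool" where
  "central_cycle V E vs \<longleftrightarrow>
     is_cycle V E vs \<and> has_perfect_matching (V - set vs) (induced_edges E (V - set vs))"

definition orientation :: "'a set set \<Rightarrow> ('a \<times> 'a) set \<Rightarrow> bool" where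
  "orientation E A \<longleftrightarrow>
     (\<forall>(u, v)\<in>A. {u, v} \<in> E) \<and>
     (\<forall>u v. {u, v} \<in> E \<longrightarrow> ((u, v) \<in> A) \<noteq> ((v, u) \<in> A))"

text \<open>The two consistent orientations of a cycle are its traversal arcs and their converse.\<close>

definition pfaffian_orientation :: "'a set \<Rightarrow> 'a set set \<Rightarrow> ('a \<times> 'a) set \<Rightarrow> bool" where
  "pfaffian_orientation V E A \<longleftrightarrow>
     orientation E A \<and>
     (\<forall>vs. central_cycle V E vs \<longrightarrow>
        odd (card (cycle_arcs vs \<inter> A)) \<and> odd (card ((cycle_arcs vs)\<inverse> \<inter> A)))"

definition pfaffian :: "'a set \<Rightarrow> 'a set set \<Rightarrow> bool" where
  "pfaffian V E \<longleftrightarrow> (\<exists>A. pfaffian_orientation V E A)"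


section \<open>Word RAM\<close>

text \<open>
  A random access machine with natural-number registers and memory cells.  Memory is accessed
  only through \<open>Load\<close> and \<open>Store\<close>, whose address is taken from a register; a program,
  being a finite list, can mention only finitely many registers.  \<open>Sub\<close> is truncated.
  The machine halts when the program counter leaves the program.
\<close>

datatype instr =
    Const nat nat          \<comment> \<open>\<open>r\<^sub>i := k\<close>\<close>
  | Add nat nat nat        \<comment> \<open>\<open>r\<^sub>i := r\<^sub>j + r\<^sub>k\<close>\<close>
  | Sub nat nat nat        \<comment> \<open>\<open>r\<^sub>i := r\<^sub>j - r\<^sub>k\<close>\<close>
  | Load nat nat           \<comment> \<open>\<open>r\<^sub>i := mem[r\<^sub>j]\<close>\<close>
  | Store nat nat          \<comment> \<open>\<open>mem[r\<^sub>i] := r\<^sub>j\<close>\<close>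
  | Jump nat               \<comment> \<open>go to \<open>l\<close>\<close>
  | JumpLess nat nat nat   \<comment> \<open>if \<open>r\<^sub>i < r\<^sub>j\<close> go to \<open>l\<close>\<close>

type_synonym program = "instr list"

record config =
  pc :: nat
  reg :: "nat \<Rightarrow> nat"
  mem :: "nat \<Rightarrow> nat"

fun exec :: "instr \<Rightarrow> config \<Rightarrow> config" where
  "exec (Const i k) s = s\<lparr>pc := Suc (pc s), reg := (reg s)(i := k)\<rparr>"
| "exec (Add i j k) s = s\<lparr>pc := Suc (pc s), reg := (reg s)(i := reg s j + reg s k)\<rparr>"
| "exec (Sub i j k) s = s\<lparr>pc := Suc (pc s), reg := (reg s)(i := reg s j - reg s k)\<rparr>"
| "exec (Load i j) s = s\<lparr>pc := Suc (pc s), reg := (reg s)(i := mem s (reg s j))\<rparr>"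
| "exec (Store i j) s = s\<lparr>pc := Suc (pc s), mem := (mem s)(reg s i := reg s j)\<rparr>"
| "exec (Jump l) s = s\<lparr>pc := l\<rparr>"
| "exec (JumpLess i j l) s = s\<lparr>pc := (if reg s i < reg s j then l else Suc (pc s))\<rparr>"

definition halted :: "program \<Rightarrow> config \<Rightarrow> bool" where
  "halted P s \<longleftrightarrow> length P \<le> pc s"

definition step :: "program \<Rightarrow> config \<Rightarrow> config" where
  "step P s = (if halted P s then s else exec (P ! pc s) s)"

definition run :: "program \<Rightarrow> nat \<Rightarrow> config \<Rightarrow> config" where
  "run P t s = (step P ^^ t) s"

text \<open>The input occupies the first memory cells; everything else is initially zero.\<close>

definition initial :: "nat list \<Rightarrow> config" where
  "initial xs = \<lparr>pc = 0, reg = (\<lambda>_. 0), mem = (\<lambda>i. if i < length xs then xs ! i else 0)\<rparr>"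

text \<open>On halting, the output is a list in memory from address 0, of the length held in register 0.\<close>

definition ram_output :: "config \<Rightarrow> nat list" where
  "ram_output s = map (mem s) [0..<reg s 0]"

text \<open>
  Every instruction has unit cost.  To make this a realistic measure, all numbers occurring in the
  computation have to fit into machine words of \<open>O(log N)\<close> bits, where \<open>N\<close> is the length of
  the input, i.e. they are bounded by \<open>N ^ c\<close> for a constant \<open>c\<close>.
\<close>

definition computes_in_linear_time :: "nat \<Rightarrow> program \<Rightarrow> nat list \<Rightarrow> nat list \<Rightarrow> bool" where
  "computes_in_linear_time c P xs ys \<longleftrightarrow>
     (\<exists>T \<le> c * length xs.
        halted P (run P T (initial xs)) \<and>
        ram_output (run P T (initial xs)) = ys \<and>
        (\<forall>t\<le>T. \<forall>i. reg (run P t (initial xs)) i \<le> length xs ^ c \<and>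
                     mem (run P t (initial xs)) i \<le> length xs ^ c))"


section \<open>Input format\<close>

text \<open>A listing of \<open>E\<close> contains every edge exactly once, in any order, endpoints in any order.\<close>

definition edge_listing :: "'a set set \<Rightarrow> ('a \<times> 'a) list \<Rightarrow> bool" where
  "edge_listing E es \<longleftrightarrow>
     distinct (map (\<lambda>(u, v). {u, v}) es) \<and> set (map (\<lambda>(u, v). {u, v}) es) = E"

text \<open>
  Input word for the graph on vertices \<open>0, ..., n - 1\<close> with edge listing \<open>es\<close>, Hamiltonian cycle
  \<open>hs\<close> and edge \<open>{a, b}\<close>.  Its length is \<open>4 + n + 2 * m\<close> for \<open>m\<close> edges (as \<open>length hs = n\<close>),
  so that time linear in the input length is time \<open>O(n + m)\<close>.
\<close>

definition encode :: "nat \<Rightarrow> (nat \<times> nat) list \<Rightarrow> nat list \<Rightarrow> nat \<times> nat \<Rightarrow> nat list" where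
  "encode n es hs e =
     [n, length es, fst e, snd e] @ hs @ concat (map (\<lambda>(u, v). [u, v]) es)"

end

theory Submission
  imports Defs
begin

text \<open>
  Number the vertices along the given cycle \<open>H\<close>, starting at the endpoint \<open>a\<close> of the anchor edge.
  After switching the Pfaffian orientation so that the path \<open>H - v\<^sub>n\<^sub>-\<^sub>1v\<^sub>0\<close> is directed, every edge
  points from its smaller to its larger position, because a chord \<open>v\<^sub>iv\<^sub>j\<close> and the subpath between
  its ends form a central cycle.  Hence every central cycle has an odd number of ascents.

  Pick a chord at every odd position \<open>u\<close>.  Putting it into the cycle overloads its even end \<open>y\<close>; take
  out the edge of \<open>H\<close> at \<open>y\<close> on the same side as \<open>u\<close> (at \<open>a\<close>: the edge that is not the anchor).
  The odd end of that edge has lost a neighbour, and its own chord is the next to be put in.  This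
  defines a map on the odd positions; exchanging edges along any of its cycles gives a spanning
  2-regular subgraph \<open>H'\<close> in which every even vertex other than \<open>a\<close> still has one lower and one higher
  neighbour.  A cycle of \<open>H'\<close> avoiding \<open>a\<close> is central with an even number of ascents, which is
  impossible.  So all of \<open>H'\<close> is a single cycle, through \<open>a\<close>.
\<close>

section \<open>Structured programs for the word RAM\<close>

text \<open>Position 0 is the one even position whose two neighbours on H both lie above it. So the
  pairing of edges at even positions says nothing about a cycle through 0, and at 0 either edge of H
  may be given up. This freedom spares the anchor, and it is the reason for numbering from one of
  its ends. The map on the odd positions need not be injective, and exchanging at all of them could
  take one edge out twice. On one of its cycles it is a permutation, and there losses and gains
  balance at every vertex. Minimum degree three supplies the chords. Bipartiteness enters twice: a
  chord and the subpath between its ends leave a path with an even number of vertices, which has a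
  perfect matching, and all cycles of H' are even, so each of them is central. Ascents come in pairs
  because every edge has exactly one even end, and the two edges at an even vertex with one lower
  and one higher neighbour are traversed both upwards or both downwards. The orientation is never
  computed: the order of the positions carries all that the construction needs of it.\<close>

datatype com =
    Skip
  | Ins instr
  | Seq com com (infixr ";;" 60)
  | IfLess nat nat com com
  | WhileLess nat nat com

section \<open>Compilation to jump code\<close>

fun csize :: "com \<Rightarrow> nat" where
  "csize Skip = 0"
| "csize (Ins _) = 1"
| "csize (c ;; d) = csize c + csize d"
| "csize (IfLess _ _ c d) = csize c + csize d + 2"
| "csize (WhileLess _ _ c) = csize c + 3"

text \<open>Jump targets are absolute, hence the start address \<open>p\<close>. The machine has no
  negated test: the else branch is laid out directly behind the test, and a loop needs an extra
  \<open>Jump\<close> to its exit.\<close>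

fun compile :: "com \<Rightarrow> nat \<Rightarrow> program" where
  "compile Skip p = []"
| "compile (Ins a) p = [a]"
| "compile (c ;; d) p = compile c p @ compile d (p + csize c)"
| "compile (IfLess i j c d) p =
     JumpLess i j (p + csize d + 2) # compile d (Suc p) @
     Jump (p + csize c + csize d + 2) # compile c (p + csize d + 2)"
| "compile (WhileLess i j c) p =
     JumpLess i j (p + 2) # Jump (p + csize c + 3) # compile c (p + 2) @ [Jump p]"

lemma length_compile [simp]: "length (compile c p) = csize c"
  by (induction c p rule: compile.induct) auto

text \<open>All registers and cells are covered, since the cost model bounds the whole configuration
  and not only what a program touches.\<close>

definition bounded :: "nat \<Rightarrow> (nat \<Rightarrow> nat) \<Rightarrow> (nat \<Rightarrow> nat) \<Rightarrow> bool" where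
  "bounded B r m \<longleftrightarrow> (\<forall>i. r i \<le> B \<and> m i \<le> B)"

definition placed :: "program \<Rightarrow> nat \<Rightarrow> program \<Rightarrow> bool" where
  "placed code p P \<longleftrightarrow> (\<exists>xs ys. P = xs @ code @ ys \<and> length xs = p)"

lemma placed_append: "placed (xs @ ys) p P \<longleftrightarrow> placed xs p P \<and> placed ys (p + length xs) P"
proof
  assume "placed (xs @ ys) p P"
  then obtain us vs where "P = us @ (xs @ ys) @ vs" "length us = p"
    by (auto simp: placed_def)
  then have "P = us @ xs @ (ys @ vs)" "P = (us @ xs) @ ys @ vs" "length (us @ xs) = p + length xs"
    by auto
  then show "placed xs p P \<and> placed ys (p + length xs) P"
    using \<open>length us = p\<close> unfolding placed_def by blast
next
  assume "placed xs p P \<and> placed ys (p + length xs) P"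
  then obtain us vs us' vs' where *: "P = us @ xs @ vs" "length us = p"
      "P = us' @ ys @ vs'" "length us' = p + length xs"
    unfolding placed_def by blast
  have "us @ xs = take (p + length xs) P" using *(1,2) by simp
  also have "\<dots> = us'" using *(3,4) by simp
  finally have "P = us @ (xs @ ys) @ vs'" using *(3) by simp
  then show "placed (xs @ ys) p P" using *(2) unfolding placed_def by blast
qed

lemma placed_Cons: "placed (a # xs) p P \<longleftrightarrow> p < length P \<and> P ! p = a \<and> placed xs (Suc p) P"
proof -
  have "placed [a] p P \<longleftrightarrow> p < length P \<and> P ! p = a"
  proof
    assume "p < length P \<and> P ! p = a"
    then have "P = take p P @ [a] @ drop (Suc p) P" "length (take p P) = p"
      by (auto simp: id_take_nth_drop)
    then show "placed [a] p P" unfolding placed_def by blast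
  qed (auto simp: placed_def)
  then show ?thesis using placed_append[of "[a]" xs p P] by simp
qed

section \<open>Runs within a word size, and timed Hoare triples\<close>

definition steps :: "nat \<Rightarrow> program \<Rightarrow> nat \<Rightarrow> config \<Rightarrow> config \<Rightarrow> bool" where
  "steps B P t s s' \<longleftrightarrow> run P t s = s' \<and> (\<forall>k\<le>t. bounded B (reg (run P k s)) (mem (run P k s)))"

lemma run_add: "run P (k + t) s = run P k (run P t s)"
  by (simp add: run_def funpow_add)

lemma steps_refl: "bounded B (reg s) (mem s) \<Longrightarrow> steps B P 0 s s"
  by (simp add: steps_def run_def)

lemma steps_trans:
  assumes "steps B P t s s'" "steps B P u s' s''"
  shows "steps B P (t + u) s s''"
  unfolding steps_def
proof (intro conjI allI impI)
  show "run P (t + u) s = s''"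
    using assms run_add[of P u t s] by (simp add: steps_def add.commute)
  fix k assume k: "k \<le> t + u"
  show "bounded B (reg (run P k s)) (mem (run P k s))"
  proof (cases "k \<le> t")
    case False
    then have "run P k s = run P (k - t) s'"
      using assms(1) run_add[of P "k - t" t s] by (simp add: steps_def)
    then show ?thesis using assms(2) k by (simp add: steps_def)
  qed (use assms(1) in \<open>simp add: steps_def\<close>)
qed

lemma steps_exec:
  assumes "bounded B (reg s) (mem s)" "pc s < length P" "exec (P ! pc s) s = s'"
    "bounded B (reg s') (mem s')"
  shows "steps B P 1 s s'"
proof -
  have "step P s = s'" using assms by (simp add: step_def halted_def)
  then show ?thesis using assms by (auto simp: steps_def run_def le_Suc_eq)
qed

abbreviation conf :: "nat \<Rightarrow> (nat \<Rightarrow> nat) \<Rightarrow> (nat \<Rightarrow> nat) \<Rightarrow> config" where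
  "conf p r m \<equiv> \<lparr>pc = p, reg = r, mem = m\<rparr>"

text \<open>Total correctness with a time bound. Quantifying over the surrounding program and the
  start address makes triples composable. The word size is an implicit obligation at every
  intermediate step, through \<open>steps\<close>.\<close>

definition hoare ::
  "nat \<Rightarrow> ((nat \<Rightarrow> nat) \<Rightarrow> (nat \<Rightarrow> nat) \<Rightarrow> bool) \<Rightarrow> com \<Rightarrow> nat \<Rightarrow>
    ((nat \<Rightarrow> nat) \<Rightarrow> (nat \<Rightarrow> nat) \<Rightarrow> bool) \<Rightarrow> bool" where
  "hoare B Q c \<tau> R \<longleftrightarrow>
     (\<forall>P p r m. placed (compile c p) p P \<longrightarrow> bounded B r m \<longrightarrow> Q r m \<longrightarrow>
        (\<exists>t\<le>\<tau>. \<exists>r' m'. steps B P t (conf p r m) (conf (p + csize c) r' m') \<and> R r' m'))"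

lemma steps_bounded: "steps B P t s s' \<Longrightarrow> bounded B (reg s') (mem s')"
  by (auto simp: steps_def)

lemma hoareI:
  assumes "\<And>P p r m. placed (compile c p) p P \<Longrightarrow> bounded B r m \<Longrightarrow> Q r m \<Longrightarrow>
    \<exists>t\<le>\<tau>. \<exists>r' m'. steps B P t (conf p r m) (conf (p + csize c) r' m') \<and> R r' m'"
  shows "hoare B Q c \<tau> R"
  unfolding hoare_def by (intro allI impI) (rule assms)

lemma hoareE:
  assumes "hoare B Q c \<tau> R" "placed (compile c p) p P" "bounded B r m" "Q r m"
  obtains t r' m' where "t \<le> \<tau>" "steps B P t (conf p r m) (conf (p + csize c) r' m')"
    "R r' m'" "bounded B r' m'"
proof -
  obtain t r' m' where *: "t \<le> \<tau>" "steps B P t (conf p r m) (conf (p + csize c) r' m')" "R r' m'"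
    using assms(1)[unfolded hoare_def, rule_format, OF assms(2-4)] by blast
  show thesis using that[OF *] steps_bounded[OF *(2)] by simp
qed

lemma hoare_conseq:
  assumes "hoare B Q c \<tau> R" "\<And>r m. Q' r m \<Longrightarrow> Q r m" "\<And>r m. R r m \<Longrightarrow> R' r m" "\<tau> \<le> \<tau>'"
  shows "hoare B Q' c \<tau>' R'"
proof (rule hoareI)
  fix P p r m
  assume *: "placed (compile c p) p P" "bounded B r m" "Q' r m"
  obtain t r' m' where 1: "t \<le> \<tau>"
      "steps B P t (conf p r m) (conf (p + csize c) r' m')" "R r' m'" "bounded B r' m'"
    by (rule hoareE[OF assms(1), OF *(1,2) assms(2)[OF *(3)]])
  show "\<exists>t\<le>\<tau>'. \<exists>r' m'. steps B P t (conf p r m) (conf (p + csize c) r' m') \<and> R' r' m'"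
    by (intro exI[of _ t] exI[of _ r'] exI[of _ m'] conjI 1(2) assms(3)[OF 1(3)]
        le_trans[OF 1(1) assms(4)])
qed

lemma hoare_Seq:
  assumes c: "hoare B Q c \<tau> R" and d: "hoare B R d \<tau>' R'"
  shows "hoare B Q (c ;; d) (\<tau> + \<tau>') R'"
proof (rule hoareI)
  fix P p r m
  assume pl: "placed (compile (c ;; d) p) p P" and b: "bounded B r m" "Q r m"
  have pl': "placed (compile c p) p P" "placed (compile d (p + csize c)) (p + csize c) P"
    using pl by (simp_all add: placed_append)
  obtain t r' m' where 1: "t \<le> \<tau>" "steps B P t (conf p r m) (conf (p + csize c) r' m')"
      "R r' m'" "bounded B r' m'"
    by (rule hoareE[OF c, OF pl'(1) b])
  obtain t' r'' m'' where 2: "t' \<le> \<tau>'"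
      "steps B P t' (conf (p + csize c) r' m') (conf (p + csize c + csize d) r'' m'')" "R' r'' m''"
      "bounded B r'' m''"
    by (rule hoareE[OF d, OF pl'(2) 1(4,3)])
  show "\<exists>t\<le>\<tau> + \<tau>'. \<exists>r' m'. steps B P t (conf p r m) (conf (p + csize (c ;; d)) r' m') \<and> R' r' m'"
    using steps_trans[OF 1(2) 2(2)] 1(1) 2(1,3)
    by (intro exI[of _ "t + t'"]) (auto simp: add.assoc)
qed

lemma hoare_IfLess:
  assumes c: "hoare B (\<lambda>r m. Q r m \<and> r i < r j) c \<tau> R"
    and d: "hoare B (\<lambda>r m. Q r m \<and> \<not> r i < r j) d \<tau>' R"
  shows "hoare B Q (IfLess i j c d) (max \<tau> \<tau>' + 2) R"
proof (rule hoareI)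
  fix P p r m
  assume pl: "placed (compile (IfLess i j c d) p) p P" and b: "bounded B r m" "Q r m"
  have pl': "p < length P" "P ! p = JumpLess i j (p + csize d + 2)"
      "placed (compile d (Suc p)) (Suc p) P" "Suc p + csize d < length P"
      "P ! (Suc p + csize d) = Jump (p + csize c + csize d + 2)"
      "placed (compile c (p + csize d + 2)) (p + csize d + 2) P"
    using pl by (simp_all add: placed_append placed_Cons)
  show "\<exists>t\<le>max \<tau> \<tau>' + 2. \<exists>r' m'.
      steps B P t (conf p r m) (conf (p + csize (IfLess i j c d)) r' m') \<and> R r' m'"
  proof (cases "r i < r j")
    case True
    have 0: "steps B P 1 (conf p r m) (conf (p + csize d + 2) r m)"
      by (rule steps_exec) (use pl' True b in auto)
    obtain t r' m' where 1: "t \<le> \<tau>"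
        "steps B P t (conf (p + csize d + 2) r m) (conf (p + csize d + 2 + csize c) r' m')" "R r' m'"
        "bounded B r' m'"
      by (rule hoareE[OF c, OF pl'(6) b(1) conjI[OF b(2) True]])
    show ?thesis
      using steps_trans[OF 0 1(2)] 1(1,3)
      by (intro exI[of _ "1 + t"]) (auto simp: algebra_simps)
  next
    case False
    have 0: "steps B P 1 (conf p r m) (conf (Suc p) r m)"
      by (rule steps_exec) (use pl' False b in auto)
    obtain t r' m' where 1: "t \<le> \<tau>'"
        "steps B P t (conf (Suc p) r m) (conf (Suc p + csize d) r' m')" "R r' m'" "bounded B r' m'"
      by (rule hoareE[OF d, OF pl'(3) b(1) conjI[OF b(2) False]])
    have 2: "steps B P 1 (conf (Suc p + csize d) r' m') (conf (p + csize c + csize d + 2) r' m')"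
      by (rule steps_exec) (use pl' 1(4) in auto)
    show ?thesis
      using steps_trans[OF steps_trans[OF 0 1(2)] 2] 1(1,3)
      by (intro exI[of _ "1 + t + 1"]) (auto simp: algebra_simps)
  qed
qed

text \<open>The invariant is indexed by the number of completed iterations, and their total
  \<open>K\<close> is known beforehand, so termination and time come together. Each iteration pays
  for the test and the jump back, the exit for the failed test and the jump out.\<close>

lemma hoare_WhileLess:
  assumes body: "\<And>k. k < K \<Longrightarrow> hoare B (I k) c \<tau> (I (Suc k))"
    and guard: "\<And>k r m. k < K \<Longrightarrow> I k r m \<Longrightarrow> r i < r j"
    and exit: "\<And>r m. I K r m \<Longrightarrow> \<not> r i < r j"
  shows "hoare B (I 0) (WhileLess i j c) (K * (\<tau> + 2) + 2) (I K)"
proof (rule hoareI)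
  fix P p r m
  assume pl: "placed (compile (WhileLess i j c) p) p P" and b: "bounded B r m" "I 0 r m"
  have pl': "p < length P" "P ! p = JumpLess i j (p + 2)" "Suc p < length P"
      "P ! (Suc p) = Jump (p + csize c + 3)" "placed (compile c (p + 2)) (p + 2) P"
      "p + 2 + csize c < length P" "P ! (p + 2 + csize c) = Jump p"
    using pl by (simp_all add: placed_append placed_Cons)
  have loop: "\<exists>t\<le>k * (\<tau> + 2). \<exists>r' m'. steps B P t (conf p r m) (conf p r' m') \<and> I k r' m'"
    if "k \<le> K" for k
    using that
  proof (induction k)
    case 0
    have "steps B P 0 (conf p r m) (conf p r m)" by (rule steps_refl) (use b in simp)
    then show ?case using b by auto
  next
    case (Suc k)
    then obtain t r' m' where 1: "t \<le> k * (\<tau> + 2)" "steps B P t (conf p r m) (conf p r' m')"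
        "I k r' m'" by auto
    have b': "bounded B r' m'" using steps_bounded[OF 1(2)] by simp
    have 0: "steps B P 1 (conf p r' m') (conf (p + 2) r' m')"
      by (rule steps_exec) (use pl' b' guard[OF _ 1(3)] Suc.prems in auto)
    have h: "hoare B (I k) c \<tau> (I (Suc k))" by (rule body) (use Suc.prems in simp)
    obtain t' r'' m'' where 2: "t' \<le> \<tau>"
        "steps B P t' (conf (p + 2) r' m') (conf (p + 2 + csize c) r'' m'')"
        "I (Suc k) r'' m''" "bounded B r'' m''"
      by (rule hoareE[OF h, OF pl'(5) b' 1(3)])
    have 3: "steps B P 1 (conf (p + 2 + csize c) r'' m'') (conf p r'' m'')"
      by (rule steps_exec) (use pl' 2(4) in auto)
    show ?case
      using steps_trans[OF steps_trans[OF steps_trans[OF 1(2) 0] 2(2)] 3] 1(1) 2(1,3)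
      by (intro exI[of _ "t + 1 + t' + 1"]) auto
  qed
  obtain t r' m' where 1: "t \<le> K * (\<tau> + 2)" "steps B P t (conf p r m) (conf p r' m')" "I K r' m'"
    using loop[of K] by auto
  have b': "bounded B r' m'" using steps_bounded[OF 1(2)] by simp
  have 2: "steps B P 1 (conf p r' m') (conf (Suc p) r' m')"
    by (rule steps_exec) (use pl' b' exit[OF 1(3)] in auto)
  have 3: "steps B P 1 (conf (Suc p) r' m') (conf (p + csize c + 3) r' m')"
    by (rule steps_exec) (use pl' b' in auto)
  show "\<exists>t\<le>K * (\<tau> + 2) + 2. \<exists>r' m'.
      steps B P t (conf p r m) (conf (p + csize (WhileLess i j c)) r' m') \<and> I K r' m'"
    using steps_trans[OF steps_trans[OF 1(2) 2] 3] 1(1,3)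
    by (intro exI[of _ "t + 1 + 1"]) (auto simp: algebra_simps)
qed

text \<open>Only \<open>Const\<close> and \<open>Add\<close> can violate a word size bound.  On jump instructions and on loops
  the precondition is the unusable \<open>False\<close>.\<close>

fun wp :: "nat \<Rightarrow> com \<Rightarrow> ((nat \<Rightarrow> nat) \<Rightarrow> (nat \<Rightarrow> nat) \<Rightarrow> bool) \<Rightarrow>
    (nat \<Rightarrow> nat) \<Rightarrow> (nat \<Rightarrow> nat) \<Rightarrow> bool" where
  "wp B Skip R r m = R r m"
| "wp B (Ins (Const i k)) R r m = (k \<le> B \<and> R (r(i := k)) m)"
| "wp B (Ins (Add i j k)) R r m = (r j + r k \<le> B \<and> R (r(i := r j + r k)) m)"
| "wp B (Ins (Sub i j k)) R r m = R (r(i := r j - r k)) m"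
| "wp B (Ins (Load i j)) R r m = R (r(i := m (r j))) m"
| "wp B (Ins (Store i j)) R r m = R r (m(r i := r j))"
| "wp B (c ;; d) R r m = wp B c (wp B d R) r m"
| "wp B (IfLess i j c d) R r m = (if r i < r j then wp B c R r m else wp B d R r m)"
| "wp B _ R r m = False"

text \<open>The value for loops is a placeholder: \<open>wp\<close> of a loop is
  \<open>False\<close>, so no bound is ever claimed for it.\<close>

fun ctime :: "com \<Rightarrow> nat" where
  "ctime Skip = 0"
| "ctime (Ins _) = 1"
| "ctime (c ;; d) = ctime c + ctime d"
| "ctime (IfLess _ _ c d) = max (ctime c) (ctime d) + 2"
| "ctime (WhileLess _ _ _) = 0"

lemma hoare_Ins:
  assumes "\<And>p r m. bounded B r m \<Longrightarrow> Q r m \<Longrightarrow>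
    \<exists>r' m'. exec a (conf p r m) = conf (Suc p) r' m' \<and> bounded B r' m' \<and> R r' m'"
  shows "hoare B Q (Ins a) 1 R"
proof (rule hoareI)
  fix P p r m
  assume pl: "placed (compile (Ins a) p) p P" and b: "bounded B r m" "Q r m"
  obtain r' m' where 1: "exec a (conf p r m) = conf (Suc p) r' m'" "bounded B r' m'" "R r' m'"
    using assms[OF b] by blast
  have "steps B P 1 (conf p r m) (conf (Suc p) r' m')"
    by (rule steps_exec) (use pl b 1 in \<open>auto simp: placed_Cons\<close>)
  then show "\<exists>t\<le>1. \<exists>r' m'. steps B P t (conf p r m) (conf (p + csize (Ins a)) r' m') \<and> R r' m'"
    using 1 by auto
qed

lemma hoare_wp: "hoare B (wp B c R) c (ctime c) R"
proof (induction c arbitrary: R)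
  case Skip
  show ?case
  proof (rule hoareI)
    fix P p r m
    assume "bounded B r m" and "wp B Skip R r m"
    then show "\<exists>t\<le>ctime Skip. \<exists>r' m'.
        steps B P t (conf p r m) (conf (p + csize Skip) r' m') \<and> R r' m'"
      using steps_refl[of B "conf p r m" P] by auto
  qed
next
  case (Ins a)
  have "hoare B (wp B (Ins a) R) (Ins a) 1 R"
  proof (rule hoare_Ins)
    fix p r m
    assume b: "bounded B r m" and "wp B (Ins a) R r m"
    then show "\<exists>r' m'. exec a (conf p r m) = conf (Suc p) r' m' \<and> bounded B r' m' \<and> R r' m'"
      by (cases a) (auto simp: bounded_def intro: le_trans[OF diff_le_self])
  qed
  then show ?case by simp
next
  case (Seq c d)
  show ?case
    by (rule hoare_conseq[OF hoare_Seq[OF Seq.IH]]) simp_all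
next
  case (IfLess i j c d)
  let ?Q = "wp B (IfLess i j c d) R"
  have "hoare B (\<lambda>r m. ?Q r m \<and> r i < r j) c (ctime c) R"
    by (rule hoare_conseq[OF IfLess.IH(1)]) auto
  moreover have "hoare B (\<lambda>r m. ?Q r m \<and> \<not> r i < r j) d (ctime d) R"
    by (rule hoare_conseq[OF IfLess.IH(2)]) auto
  ultimately show ?case
    unfolding ctime.simps by (rule hoare_IfLess)
next
  case (WhileLess i j c)
  show ?case by (rule hoareI) simp
qed

lemma hoare_vcg:
  assumes "\<And>r m. bounded B r m \<Longrightarrow> Q r m \<Longrightarrow> wp B c R r m"
  shows "hoare B Q c (ctime c) R"
proof (rule hoareI)
  fix P p r m
  assume *: "placed (compile c p) p P" "bounded B r m" "Q r m"
  show "\<exists>t\<le>ctime c. \<exists>r' m'. steps B P t (conf p r m) (conf (p + csize c) r' m') \<and> R r' m'"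
    using hoare_wp[unfolded hoare_def, rule_format, OF *(1,2) assms[OF *(2,3)]] .
qed


section \<open>Cycles in 2-regular graphs\<close>

definition two_regular :: "'b set \<Rightarrow> ('b \<Rightarrow> 'b set) \<Rightarrow> bool" where
  "two_regular W nb \<longleftrightarrow> finite W \<and>
     (\<forall>v\<in>W. card (nb v) = 2 \<and> nb v \<subseteq> W \<and> v \<notin> nb v \<and> (\<forall>w\<in>nb v. v \<in> nb w))"

lemma card_two_eq:
  assumes "card A = 2" "x \<in> A" "y \<in> A" "x \<noteq> y"
  shows "A = {x, y}"
proof -
  have "finite A" using assms(1) card.infinite by fastforce
  then show ?thesis
    using card_subset_eq[of A "{x, y}"] assms by auto
qed

text \<open>The closing edge exists because a longest path starting with \<open>v, w\<close> can neither be extended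
  nor return to one of its inner vertices, whose two neighbours are already used.\<close>

lemma two_regular_cycle:
  assumes reg: "two_regular W nb" and v: "v \<in> W" and w: "w \<in> nb v"
  obtains vs where "distinct vs" "set vs \<subseteq> W" "3 \<le> length vs" "vs ! 0 = v" "vs ! 1 = w"
    "\<And>i. i < length vs \<Longrightarrow>
      nb (vs ! (Suc i mod length vs)) = {vs ! i, vs ! (Suc (Suc i) mod length vs)}"
proof -
  have fin: "finite W" and nbW: "\<And>x. x \<in> W \<Longrightarrow> nb x \<subseteq> W" and irr: "\<And>x. x \<in> W \<Longrightarrow> x \<notin> nb x"
    and two: "\<And>x. x \<in> W \<Longrightarrow> card (nb x) = 2" and sym: "\<And>x y. x \<in> W \<Longrightarrow> y \<in> nb x \<Longrightarrow> x \<in> nb y"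
    using reg by (auto simp: two_regular_def)
  define Q where "Q vs \<longleftrightarrow> distinct vs \<and> set vs \<subseteq> W \<and> 2 \<le> length vs \<and> vs ! 0 = v \<and> vs ! 1 = w \<and>
    (\<forall>i. Suc i < length vs \<longrightarrow> vs ! Suc i \<in> nb (vs ! i))" for vs
  have "Q [v, w]"
    using v w nbW irr by (auto simp: Q_def)
  moreover have "\<forall>vs. Q vs \<longrightarrow> length vs < Suc (card W)"
    using fin by (auto simp: Q_def less_Suc_eq_le distinct_card[symmetric] intro: card_mono)
  ultimately obtain vs where Q: "Q vs" and max: "\<And>us. Q us \<Longrightarrow> length us \<le> length vs"
    using ex_has_greatest_nat[of Q "[v, w]" length "Suc (card W)"] by metis
  have d: "distinct vs" and sub: "set vs \<subseteq> W" and len: "2 \<le> length vs"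
    and path: "\<And>i. Suc i < length vs \<Longrightarrow> vs ! Suc i \<in> nb (vs ! i)"
    using Q by (auto simp: Q_def)
  have inW: "\<And>i. i < length vs \<Longrightarrow> vs ! i \<in> W" using sub by auto
  have path': "vs ! i \<in> nb (vs ! Suc i)" if "Suc i < length vs" for i
    using sym[OF inW path[OF that]] that by simp
  define k where "k = length vs - 1"
  have k: "1 \<le> k" "length vs = Suc k" using len by (auto simp: k_def)
  have pk: "vs ! (k - 1) \<in> nb (vs ! k)" using path'[of "k - 1"] k by simp
  have "\<exists>q. q \<in> nb (vs ! k) \<and> q \<noteq> vs ! (k - 1)"
  proof (rule ccontr)
    assume "\<not> ?thesis"
    then have "nb (vs ! k) \<subseteq> {vs ! (k - 1)}" by auto
    then have "card (nb (vs ! k)) \<le> 1" using card_mono[of "{vs ! (k - 1)}"] by fastforce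
    then show False using two[OF inW[of k]] k by simp
  qed
  then obtain q where q: "q \<in> nb (vs ! k)" "q \<noteq> vs ! (k - 1)" by blast
  have qW: "q \<in> W" using nbW[OF inW[of k]] q k by auto
  have "q \<in> set vs"
  proof (rule ccontr)
    assume nq: "q \<notin> set vs"
    have "Q (vs @ [q])"
      unfolding Q_def using Q d sub nq qW q k
      by (auto simp: Q_def nth_append less_Suc_eq)
    from max[OF this] show False by simp
  qed
  then obtain i where i: "i < length vs" "q = vs ! i" by (auto simp: in_set_conv_nth)
  have ik: "i \<noteq> k" using irr[OF inW[of k]] q i k by auto
  have ik1: "i \<noteq> k - 1" using q i by auto
  have "i = 0"
  proof (rule ccontr)
    assume "i \<noteq> 0"
    then have j: "0 < i" "Suc i < k" using i ik ik1 k by auto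
    have "vs ! (i - 1) \<in> nb (vs ! i)" using path'[of "i - 1"] j i by simp
    moreover have "vs ! Suc i \<in> nb (vs ! i)" using path[of i] j k by simp
    moreover have "vs ! k \<in> nb (vs ! i)" using sym[OF inW[of k]] q i k by auto
    ultimately have "{vs ! (i - 1), vs ! Suc i, vs ! k} \<subseteq> nb (vs ! i)" by auto
    moreover have "card {vs ! (i - 1), vs ! Suc i, vs ! k} = 3"
      using d j k by (auto simp: card_insert_if nth_eq_iff_index_eq)
    moreover have "finite (nb (vs ! i))" using two[OF inW[OF i(1)]] card.infinite by fastforce
    ultimately have "3 \<le> card (nb (vs ! i))" by (metis card_mono)
    then show False using two[OF inW[OF i(1)]] by simp
  qed
  then have close: "vs ! 0 \<in> nb (vs ! k)" and k2: "2 \<le> k" using q i ik ik1 by auto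
  have succ: "vs ! (Suc j mod length vs) \<in> nb (vs ! j)" if "j < length vs" for j
    using path[of j] close that k by (cases "j = k") auto
  have *: "nb (vs ! (Suc j mod length vs)) = {vs ! j, vs ! (Suc (Suc j) mod length vs)}"
    if j: "j < length vs" for j
  proof (rule card_two_eq)
    have l: "Suc j mod length vs < length vs" using k by simp
    show "card (nb (vs ! (Suc j mod length vs))) = 2" using two[OF inW[OF l]] .
    show "vs ! j \<in> nb (vs ! (Suc j mod length vs))" using sym[OF inW[OF j] succ[OF j]] .
    show "vs ! (Suc (Suc j) mod length vs) \<in> nb (vs ! (Suc j mod length vs))"
      using succ[OF l] by (simp add: mod_Suc_eq)
    have "Suc (Suc j) mod length vs \<noteq> j"
      using j k k2 by (auto simp: mod_Suc)
    then show "vs ! j \<noteq> vs ! (Suc (Suc j) mod length vs)"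
      using d j k by (simp add: nth_eq_iff_index_eq)
  qed
  show ?thesis
    using that[of vs] d sub k k2 * Q by (auto simp: Q_def)
qed

text \<open>The neighbourhood equations of a cycle are stated at successor indices, which avoids
  predecessors modulo the length. Here they are read at an arbitrary index.\<close>

lemma two_regular_cycle_nb:
  assumes "3 \<le> length vs"
    and nb: "\<And>i. i < length vs \<Longrightarrow>
      nb (vs ! (Suc i mod length vs)) = {vs ! i, vs ! (Suc (Suc i) mod length vs)}"
    and j: "j < length vs"
  shows "nb (vs ! j) \<subseteq> set vs" "vs ! (Suc j mod length vs) \<in> nb (vs ! j)"
proof -
  obtain i where i: "i < length vs" "Suc i mod length vs = j"
  proof (cases "j = 0")
    case True
    then show ?thesis using that[of "length vs - 1"] assms(1) by (cases "length vs") simp_all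
  next
    case False
    then show ?thesis using that[of "j - 1"] j by simp
  qed
  have "Suc (Suc i) mod length vs = Suc j mod length vs"
    using i(2) by (metis mod_Suc_eq)
  then have *: "nb (vs ! j) = {vs ! i, vs ! (Suc j mod length vs)}" using nb[OF i(1)] i(2) by simp
  have "Suc j mod length vs < length vs" using j by (intro mod_less_divisor) auto
  then show "nb (vs ! j) \<subseteq> set vs" using * i(1) by auto
  show "vs ! (Suc j mod length vs) \<in> nb (vs ! j)" using * by simp
qed

text \<open>By symmetry, an edge from outside into the closed set \<open>U\<close> would be an edge
  leaving \<open>U\<close>.\<close>

lemma two_regular_Diff:
  assumes reg: "two_regular W nb" and closed: "\<And>v. v \<in> U \<Longrightarrow> nb v \<subseteq> U"
  shows "two_regular (W - U) nb"
  using assms unfolding two_regular_def by auto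

text \<open>The colour is determined by the parity of the index; the closing edge then forces the
  last index to be odd.\<close>

lemma alternating_colours:
  assumes vs: "3 \<le> length vs"
    and col: "\<And>i. i < length vs \<Longrightarrow> col (vs ! i) \<noteq> (col (vs ! (Suc i mod length vs)) :: bool)"
  shows "\<And>i. i < length vs \<Longrightarrow> col (vs ! i) \<longleftrightarrow> (col (vs ! 0) \<noteq> odd i)" "even (length vs)"
proof -
  show *: "col (vs ! i) \<longleftrightarrow> (col (vs ! 0) \<noteq> odd i)" if "i < length vs" for i
    using that
  proof (induction i)
    case (Suc i)
    then show ?case using col[of i] by auto
  qed simp
  have "col (vs ! (length vs - 1)) \<noteq> col (vs ! 0)"
    using col[of "length vs - 1"] vs by (cases "length vs") simp_all
  moreover have "length vs - 1 < length vs" using vs by simp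
  ultimately have "odd (length vs - 1)" using *[of "length vs - 1"] by blast
  then show "even (length vs)" using vs by simp
qed

text \<open>Induction on the number of vertices, splitting off one cycle at a time. A properly
  2-coloured cycle is even, so every other edge of it can be taken.\<close>

lemma two_regular_matching:
  assumes "two_regular W nb" and col: "\<And>v w. v \<in> W \<Longrightarrow> w \<in> nb v \<Longrightarrow> col v \<noteq> (col w :: bool)"
  shows "\<exists>\<mu>. \<forall>v\<in>W. \<mu> v \<in> nb v \<and> \<mu> v \<in> W \<and> \<mu> (\<mu> v) = v"
  using assms
proof (induction "card W" arbitrary: W rule: less_induct)
  case less
  note reg = less.prems(1) and col = less.prems(2)
  show ?case
  proof (cases "W = {}")
    case False
    then obtain v where v: "v \<in> W" by blast
    then have "nb v \<noteq> {}" using reg by (fastforce simp: two_regular_def)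
    then obtain w where w: "w \<in> nb v" by blast
    obtain vs where vs: "distinct vs" "set vs \<subseteq> W" "3 \<le> length vs" "vs ! 0 = v"
      and nb: "\<And>i. i < length vs \<Longrightarrow>
        nb (vs ! (Suc i mod length vs)) = {vs ! i, vs ! (Suc (Suc i) mod length vs)}"
      using two_regular_cycle[OF reg v w] by metis
    have cyc: "nb (vs ! j) \<subseteq> set vs" "vs ! (Suc j mod length vs) \<in> nb (vs ! j)"
      if "j < length vs" for j
      using two_regular_cycle_nb[of vs nb j] vs(3) nb that by blast+
    have inW: "\<And>i. i < length vs \<Longrightarrow> vs ! i \<in> W" using vs(2) by auto
    have ev: "even (length vs)"
      using alternating_colours(2)[OF vs(3), of col] col[OF inW cyc(2)] by blast
    define U where "U = W - set vs"
    have "two_regular U nb"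
      unfolding U_def by (rule two_regular_Diff[OF reg]) (use cyc(1) in \<open>auto simp: in_set_conv_nth\<close>)
    moreover have "card U < card W"
    proof (rule psubset_card_mono)
      have "v \<in> set vs" using vs(3,4) nth_mem[of 0 vs] by fastforce
      then show "U \<subset> W" using v by (auto simp: U_def)
    qed (use reg in \<open>simp add: two_regular_def\<close>)
    ultimately obtain \<mu> where \<mu>: "\<forall>x\<in>U. \<mu> x \<in> nb x \<and> \<mu> x \<in> U \<and> \<mu> (\<mu> x) = x"
      using less.hyps[of U] col by (metis DiffD1 U_def)
    define ix where "ix x = (THE i. i < length vs \<and> vs ! i = x)" for x
    have ix: "ix (vs ! i) = i" if "i < length vs" for i
      unfolding ix_def using vs(1) that by (auto simp: nth_eq_iff_index_eq)
    \<comment> \<open>Partners are the indices \<open>2 * t\<close> and \<open>Suc (2 * t)\<close>;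
      the even length keeps the partner of the last index in range.\<close>
    define pt where "pt i = (if even i then Suc i else i - 1)" for i :: nat
    have pt: "pt i < length vs" "pt (pt i) = i" if "i < length vs" for i
      using that ev by (auto simp: pt_def elim!: oddE evenE)
    have nb_pt: "vs ! pt i \<in> nb (vs ! i)" if i: "i < length vs" for i
    proof (cases "even i")
      case True
      then have "Suc i < length vs" using pt(1)[OF i] by (simp add: pt_def)
      then show ?thesis using cyc(2)[OF i] True by (simp add: pt_def)
    next
      case False
      then have "vs ! i \<in> nb (vs ! (i - 1))" using cyc(2)[of "i - 1"] i by (cases i) auto
      moreover have "vs ! (i - 1) \<in> W" using inW i by simp
      ultimately show ?thesis using reg False by (auto simp: two_regular_def pt_def)
    qed
    define \<nu> where "\<nu> x = (if x \<in> set vs then vs ! pt (ix x) else \<mu> x)" for x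
    have "\<nu> x \<in> nb x \<and> \<nu> x \<in> W \<and> \<nu> (\<nu> x) = x" if x: "x \<in> W" for x
    proof (cases "x \<in> set vs")
      case True
      then obtain i where "i < length vs" "x = vs ! i" by (auto simp: in_set_conv_nth)
      then show ?thesis using pt[of i] nb_pt[of i] inW[of "pt i"] by (simp add: \<nu>_def ix)
    next
      case False
      then show ?thesis using \<mu> x by (auto simp: \<nu>_def U_def)
    qed
    then show ?thesis by blast
  qed auto
qed

lemma has_perfect_matchingI:
  assumes "\<And>v. v \<in> W \<Longrightarrow> {v, \<mu> v} \<in> E \<and> \<mu> v \<in> W \<and> \<mu> (\<mu> v) = v"
  shows "has_perfect_matching W (induced_edges E W)"
  unfolding has_perfect_matching_def
proof (intro exI conjI ballI)
  show "{{v, \<mu> v} | v. v \<in> W} \<subseteq> induced_edges E W"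
    using assms by (auto simp: induced_edges_def)
  fix v assume v: "v \<in> W"
  show "\<exists>!e. e \<in> {{v, \<mu> v} | v. v \<in> W} \<and> v \<in> e"
  proof (rule ex1I[of _ "{v, \<mu> v}"])
    fix e assume "e \<in> {{v, \<mu> v} | v. v \<in> W} \<and> v \<in> e"
    then obtain u where u: "u \<in> W" "e = {u, \<mu> u}" "v = u \<or> v = \<mu> u" by auto
    then show "e = {v, \<mu> v}" using assms[OF u(1)] by auto
  qed (use v in auto)
qed


section \<open>Pfaffian orientations along a Hamiltonian cycle\<close>

declare sum_of_bool_eq [simp del]

text \<open>Arcs are counted by sums of 0/1 terms rather than by cardinalities, because such sums
  split, shift and add pointwise.\<close>

lemma odd_card_Collect_less:
  "odd (card {k. k < l \<and> P k}) \<longleftrightarrow> odd (\<Sum>k<l. of_bool (P k) :: nat)" for l :: nat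
proof -
  have "{k. k < l \<and> P k} = {..<l} \<inter> {k. P k}" by auto
  then show ?thesis by (simp add: sum_of_bool_eq)
qed

lemma card_cycle_arcs_Int:
  assumes "distinct vs"
  shows "card (cycle_arcs vs \<inter> A) =
    card {k. k < length vs \<and> (vs ! k, vs ! (Suc k mod length vs)) \<in> A}"
proof -
  have "cycle_arcs vs \<inter> A = (\<lambda>k. (vs ! k, vs ! (Suc k mod length vs))) `
      {k. k < length vs \<and> (vs ! k, vs ! (Suc k mod length vs)) \<in> A}"
    by (auto simp: cycle_arcs_def)
  moreover have "inj_on (\<lambda>k. (vs ! k, vs ! (Suc k mod length vs)))
      {k. k < length vs \<and> (vs ! k, vs ! (Suc k mod length vs)) \<in> A}"
    using assms by (auto simp: inj_on_def nth_eq_iff_index_eq)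
  ultimately show ?thesis by (simp add: card_image)
qed

lemma cycle_edges_eq: "cycle_edges vs = {{vs ! k, vs ! (Suc k mod length vs)} | k. k < length vs}"
  by (auto simp: cycle_edges_def cycle_arcs_def)

text \<open>Lets the contributions of the two ends of the edges of a cycle cancel modulo 2.\<close>

lemma sum_Suc_mod: "(\<Sum>k<l. g (Suc k mod l)) = (\<Sum>k<l. g k)" for g :: "nat \<Rightarrow> nat"
proof (cases l)
  case (Suc p)
  have "(\<Sum>k<p. g (Suc k mod l)) = (\<Sum>k<p. g (Suc k))"
    by (rule sum.cong) (use Suc in auto)
  then have "(\<Sum>k<l. g (Suc k mod l)) = (\<Sum>k<p. g (Suc k)) + g 0"
    using Suc by simp
  then show ?thesis
    using Suc by (simp only: sum.lessThan_Suc_shift)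
qed simp

lemma sum_lessThan_add:
  "(\<Sum>k<i + d. f k) = (\<Sum>k<i. f k) + (\<Sum>k<d. f (i + k))" for f :: "nat \<Rightarrow> nat"
  by (induction d) auto

lemma even_sum_pairs:
  assumes "\<And>t. t < h \<Longrightarrow> P (2 * t) = P (Suc (2 * t))"
  shows "even (\<Sum>k<2 * h. of_bool (P k) :: nat)"
  using assms by (induction h) auto

locale hamiltonian_pfaffian =
  fixes V :: "'a set" and E :: "'a set set" and A :: "('a \<times> 'a) set" and hs :: "'a list"
  assumes simple: "simple_graph V E"
    and bip: "bipartite V E"
    and pf: "pfaffian_orientation V E A"
    and ham: "hamiltonian_cycle V E hs"
begin

abbreviation n :: nat where "n \<equiv> length hs"

abbreviation adj :: "nat \<Rightarrow> nat \<Rightarrow> bool" where "adj i j \<equiv> {hs ! i, hs ! j} \<in> E"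

lemma distinct_hs: "distinct hs" and set_hs: "set hs = V" and n3: "3 \<le> n"
  using ham by (auto simp: hamiltonian_cycle_def is_cycle_def)

lemma hs_eq_iff: "i < n \<Longrightarrow> j < n \<Longrightarrow> hs ! i = hs ! j \<longleftrightarrow> i = j"
  using distinct_hs by (simp add: nth_eq_iff_index_eq)

lemma adj_commute: "adj i j \<longleftrightarrow> adj j i"
  by (simp add: insert_commute)

lemma adj_Suc_mod: "i < n \<Longrightarrow> adj i (Suc i mod n)"
  using ham by (auto simp: hamiltonian_cycle_def is_cycle_def cycle_edges_eq)

lemma not_adj_refl: "\<not> adj i i"
proof
  assume "adj i i"
  then obtain u v where "u \<noteq> v" "{hs ! i, hs ! i} = {u, v}"
    using simple unfolding simple_graph_def by blast
  then show False by (auto simp: doubleton_eq_iff)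
qed

lemma parity: "even n" "\<And>i j. i < n \<Longrightarrow> j < n \<Longrightarrow> adj i j \<Longrightarrow> odd i \<longleftrightarrow> even j"
proof -
  obtain X Y where XY: "X \<inter> Y = {}" "\<forall>e\<in>E. \<exists>x\<in>X. \<exists>y\<in>Y. e = {x, y}"
    using bip unfolding bipartite_def by auto
  have col: "(u \<in> X) \<noteq> (v \<in> X)" if uv: "{u, v} \<in> E" for u v
  proof -
    obtain x y where "x \<in> X" "y \<in> Y" "{u, v} = {x, y}"
      using XY(2) uv by meson
    then show ?thesis using XY(1) by (auto simp: doubleton_eq_iff)
  qed
  have c: "(hs ! i \<in> X) \<noteq> (hs ! (Suc i mod n) \<in> X)" if "i < n" for i
    by (rule col) (rule adj_Suc_mod[OF that])
  show "even n"
    by (rule alternating_colours(2)[of hs "\<lambda>v. v \<in> X", OF n3]) (rule c)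
  have alt: "hs ! i \<in> X \<longleftrightarrow> (hs ! 0 \<in> X) \<noteq> odd i" if "i < n" for i
    by (rule alternating_colours(1)[of hs "\<lambda>v. v \<in> X", OF n3]) (fact c, fact that)
  show "odd i \<longleftrightarrow> even j" if "i < n" "j < n" "adj i j" for i j
    using col[OF that(3)] alt[OF that(1)] alt[OF that(2)] by auto
qed

lemma is_cycle_indices:
  assumes "distinct is" "set is \<subseteq> {..<n}" "3 \<le> length is"
    "\<And>k. k < length is \<Longrightarrow> adj (is ! k) (is ! (Suc k mod length is))"
  shows "is_cycle V E (map ((!) hs) is)"
  unfolding is_cycle_def
proof (intro conjI)
  show "distinct (map ((!) hs) is)"
    using assms(1,2) hs_eq_iff by (auto simp: distinct_map inj_on_def)
  show "set (map ((!) hs) is) \<subseteq> V"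
    using assms(2) set_hs by (auto simp: subset_iff)
  have "Suc k mod length is < length is" if "k < length is" for k
    by (rule mod_less_divisor) (use that in linarith)
  then show "cycle_edges (map ((!) hs) is) \<subseteq> E"
    using assms(4) by (auto simp: cycle_edges_eq)
qed (use assms(3) in simp)

text \<open>Transfers a cycle of positions to the graph. The matching of the complement is given as
  an involution \<open>\<mu>\<close> that moves along edges.\<close>

lemma central_cycle_indices:
  assumes "distinct is" "set is \<subseteq> {..<n}" "3 \<le> length is"
    "\<And>k. k < length is \<Longrightarrow> adj (is ! k) (is ! (Suc k mod length is))"
    and \<mu>: "\<And>i. i < n \<Longrightarrow> i \<notin> set is \<Longrightarrow> \<mu> i < n \<and> \<mu> i \<notin> set is \<and> adj i (\<mu> i) \<and> \<mu> (\<mu> i) = i"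
  shows "central_cycle V E (map ((!) hs) is)"
  unfolding central_cycle_def
proof
  define ix where "ix v = (THE i. i < n \<and> hs ! i = v)" for v
  have ix: "ix (hs ! i) = i" if "i < n" for i
    unfolding ix_def using that hs_eq_iff by auto
  have out: "hs ! i \<notin> set (map ((!) hs) is)" if "i < n" "i \<notin> set is" for i
    using that assms(2) hs_eq_iff by (auto simp: subset_iff)
  show "has_perfect_matching (V - set (map ((!) hs) is))
      (induced_edges E (V - set (map ((!) hs) is)))"
  proof (rule has_perfect_matchingI[where \<mu> = "\<lambda>v. hs ! \<mu> (ix v)"])
    fix v assume v: "v \<in> V - set (map ((!) hs) is)"
    then have "v \<in> set hs" using set_hs by simp
    then obtain i where i: "i < n" "v = hs ! i" by (metis in_set_conv_nth)
    have "i \<notin> set is" using v i(2) by auto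
    note i = i this
    show "{v, hs ! \<mu> (ix v)} \<in> E \<and> hs ! \<mu> (ix v) \<in> V - set (map ((!) hs) is) \<and>
        hs ! \<mu> (ix (hs ! \<mu> (ix v))) = v"
      using \<mu>[OF i(1,3)] out[of "\<mu> i"] i set_hs ix by (auto simp: subset_iff)
  qed
qed (rule is_cycle_indices[OF assms(1-4)])

lemma odd_forward_arcs:
  assumes "distinct is" "set is \<subseteq> {..<n}" "central_cycle V E (map ((!) hs) is)"
  shows "odd (\<Sum>k<length is. of_bool ((hs ! (is ! k), hs ! (is ! (Suc k mod length is))) \<in> A) :: nat)"
proof -
  let ?vs = "map ((!) hs) is"
  have "distinct ?vs"
    using assms(1,2) hs_eq_iff by (auto simp: distinct_map inj_on_def)
  moreover have "odd (card (cycle_arcs ?vs \<inter> A))"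
    using pf assms(3) by (auto simp: pfaffian_orientation_def)
  ultimately have "odd (\<Sum>k<length is.
      of_bool ((?vs ! k, ?vs ! (Suc k mod length is)) \<in> A) :: nat)"
    unfolding card_cycle_arcs_Int[OF \<open>distinct ?vs\<close>] odd_card_Collect_less by simp
  also have "(\<Sum>k<length is. of_bool ((?vs ! k, ?vs ! (Suc k mod length is)) \<in> A) :: nat) =
      (\<Sum>k<length is. of_bool ((hs ! (is ! k), hs ! (is ! (Suc k mod length is))) \<in> A))"
  proof (rule sum.cong)
    fix k assume "k \<in> {..<length is}"
    then have "k < length is" "Suc k mod length is < length is"
      by (auto intro!: mod_less_divisor)
    then show "of_bool ((?vs ! k, ?vs ! (Suc k mod length is)) \<in> A) =
        (of_bool ((hs ! (is ! k), hs ! (is ! (Suc k mod length is))) \<in> A) :: nat)"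
      by simp
  qed simp
  finally show ?thesis .
qed

text \<open>Switching the orientation at the positions satisfying \<open>switch\<close> turns the path
  \<open>hs\<close> into a directed path.\<close>

definition switch :: "nat \<Rightarrow> bool" where
  "switch i = odd (\<Sum>k<i. of_bool ((hs ! k, hs ! Suc k) \<notin> A) :: nat)"

text \<open>The positions from \<open>i\<close> to \<open>j\<close> and the edge between
  \<open>i\<close> and \<open>j\<close> form a central cycle. Its forward arcs are odd in number,
  and so is the length \<open>d\<close> of the subpath; hence the closing arc from \<open>j\<close>
  to \<open>i\<close> is in \<open>A\<close> iff the subpath has an odd number of backward arcs,
  which is when \<open>switch\<close> changes between \<open>i\<close> and \<open>j\<close>.\<close>

lemma arc_iff_less:
  assumes ij: "i < j" "j < n" "adj i j"
  shows "(hs ! i, hs ! j) \<in> A \<longleftrightarrow> switch i = switch j"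
proof (cases "j = Suc i")
  case True
  then show ?thesis by (auto simp: switch_def)
next
  case False
  define d where "d = j - i"
  have par: "odd i \<longleftrightarrow> even j" using parity(2) ij by simp
  have d: "j = i + d" "odd d" "3 \<le> d"
  proof -
    show "j = i + d" "odd d" using ij par by (auto simp: d_def)
    then show "3 \<le> d" using False by (cases "d = 1"; cases "d = 2"; cases "d = 0") auto
  qed
  define js where "js = [i..<Suc j]"
  have len: "length js = Suc d" using d by (simp add: js_def)
  have js: "js ! k = i + k" if "k \<le> d" for k using that d unfolding js_def by (subst nth_upt) auto
  have set_js: "set js = {i..j}" by (auto simp: js_def)
  have sub: "set js \<subseteq> {..<n}" using ij set_js by auto
  \<comment> \<open>The remaining positions \<open>j + 1\<close>, ..., \<open>n - 1\<close>, 0, ...,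
    \<open>i - 1\<close> form a path along the cycle. Its first position \<open>j + 1\<close> has
    the parity of \<open>i\<close>, so positions of that parity are matched with their successors
    and the others with their predecessors.\<close>
  define \<mu> where "\<mu> p = (if even p = even i then Suc p mod n else if p = 0 then n - 1 else p - 1)"
    for p
  have \<mu>: "\<mu> p < n \<and> \<mu> p \<notin> set js \<and> adj p (\<mu> p) \<and> \<mu> (\<mu> p) = p"
    if p: "p < n" "p \<notin> set js" for p
  proof (cases "even p = even i")
    case True
    then have q: "\<mu> p = Suc p mod n" by (simp add: \<mu>_def)
    have l: "\<mu> p < n" unfolding q by (rule mod_less_divisor) (use p in linarith)
    have "\<mu> p \<notin> set js"
    proof (cases "Suc p = n")
      case True
      then have "odd i" using parity(1) \<open>even p = even i\<close> by (metis even_Suc)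
      then show ?thesis using q True set_js by (auto intro: Nat.gr0I)
    next
      case False
      then have "\<mu> p = Suc p" using q p by simp
      moreover have "i \<noteq> Suc p" using \<open>even p = even i\<close> by auto
      ultimately show ?thesis using p set_js by auto
    qed
    moreover have "\<mu> (\<mu> p) = p"
    proof (cases "Suc p = n")
      case True
      then have "odd i" using parity(1) \<open>even p = even i\<close> by (metis even_Suc)
      then show ?thesis using q True by (simp add: \<mu>_def)
    next
      case False
      then have "\<mu> p = Suc p" using q p by simp
      then show ?thesis using True by (simp add: \<mu>_def)
    qed
    ultimately show ?thesis using l adj_Suc_mod[OF p(1)] q by simp
  next
    case False
    show ?thesis
    proof (cases "p = 0")
      case True
      then have *: "odd i" "\<mu> p = n - 1" using False by (auto simp: \<mu>_def)
      then have "even j" using par by simp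
      then have "j \<noteq> n - 1" using parity(1) n3 by auto
      then have "n - 1 \<notin> set js" using ij set_js by auto
      moreover have "\<mu> (n - 1) = 0"
        using * parity(1) n3 by (auto simp: \<mu>_def)
      moreover have "adj 0 (n - 1)"
        using adj_Suc_mod[of "n - 1"] n3 adj_commute by (cases n) auto
      ultimately show ?thesis using True * n3 by simp
    next
      case p0: False
      then have *: "\<mu> p = p - 1" using False by (auto simp: \<mu>_def)
      have "p \<noteq> Suc j" using False par by auto
      then have "p - 1 \<notin> set js" using p p0 set_js by auto
      moreover have "\<mu> (p - 1) = p" using False p0 p by (auto simp: \<mu>_def)
      moreover have "adj p (p - 1)"
        using adj_Suc_mod[of "p - 1"] p p0 adj_commute by simp
      ultimately show ?thesis using p p0 * by simp
    qed
  qed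
  have "central_cycle V E (map ((!) hs) js)"
  proof (rule central_cycle_indices[where \<mu> = \<mu>])
    fix k assume k: "k < length js"
    show "adj (js ! k) (js ! (Suc k mod length js))"
    proof (cases "k = d")
      case True
      then show ?thesis using js[of d] js[of 0] len ij(3) d adj_commute by simp
    next
      case False
      then show ?thesis using js[of k] js[of "Suc k"] len k adj_Suc_mod[of "i + k"] d ij by simp
    qed
  qed (use sub len d \<mu> in \<open>simp_all add: js_def\<close>)
  from odd_forward_arcs[OF _ sub this]
  have "odd (\<Sum>k<Suc d. of_bool ((hs ! (js ! k), hs ! (js ! (Suc k mod Suc d))) \<in> A) :: nat)"
    using len by (simp add: js_def)
  also have "(\<Sum>k<Suc d. of_bool ((hs ! (js ! k), hs ! (js ! (Suc k mod Suc d))) \<in> A) :: nat) =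
      (\<Sum>k<d. of_bool ((hs ! (i + k), hs ! Suc (i + k)) \<in> A)) + of_bool ((hs ! j, hs ! i) \<in> A)"
  proof -
    have "(\<Sum>k<d. of_bool ((hs ! (js ! k), hs ! (js ! (Suc k mod Suc d))) \<in> A) :: nat) =
        (\<Sum>k<d. of_bool ((hs ! (i + k), hs ! Suc (i + k)) \<in> A))"
      by (rule sum.cong) (use js in auto)
    then show ?thesis using js[of 0] js[of d] d(1) by simp
  qed
  finally have 1: "odd ((\<Sum>k<d. of_bool ((hs ! (i + k), hs ! Suc (i + k)) \<in> A)) +
      of_bool ((hs ! j, hs ! i) \<in> A) :: nat)" .
  have "(\<Sum>k<d. of_bool ((hs ! (i + k), hs ! Suc (i + k)) \<in> A)) +
      (\<Sum>k<d. of_bool ((hs ! (i + k), hs ! Suc (i + k)) \<notin> A)) = (\<Sum>k<d. 1 :: nat)"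
    unfolding sum.distrib[symmetric] by (rule sum.cong) auto
  then have 2: "odd ((\<Sum>k<d. of_bool ((hs ! (i + k), hs ! Suc (i + k)) \<in> A)) +
      (\<Sum>k<d. of_bool ((hs ! (i + k), hs ! Suc (i + k)) \<notin> A)) :: nat)"
    using d(2) by simp
  have 3: "switch j \<longleftrightarrow>
      (switch i \<noteq> odd (\<Sum>k<d. of_bool ((hs ! (i + k), hs ! Suc (i + k)) \<notin> A) :: nat))"
    by (simp add: switch_def d(1) sum_lessThan_add)
  have "(hs ! j, hs ! i) \<in> A \<longleftrightarrow> switch i \<noteq> switch j"
    using 1 2 3 by (auto split: if_splits)
  moreover have "((hs ! i, hs ! j) \<in> A) \<noteq> ((hs ! j, hs ! i) \<in> A)"
    using pf ij(3) by (auto simp: pfaffian_orientation_def orientation_def)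
  ultimately show ?thesis by blast
qed

text \<open>Up to switching, \<open>A\<close> orients every edge upwards.\<close>

lemma arc_iff:
  assumes "i < n" "j < n" "adj i j"
  shows "(hs ! i, hs ! j) \<in> A \<longleftrightarrow> ((i < j) \<noteq> (switch i \<noteq> switch j))"
proof (cases "i < j")
  case True
  then show ?thesis using arc_iff_less assms by auto
next
  case False
  then have "j < i" using assms(3) not_adj_refl by (metis linorder_neqE_nat)
  moreover have "((hs ! i, hs ! j) \<in> A) \<noteq> ((hs ! j, hs ! i) \<in> A)"
    using pf assms(3) by (auto simp: pfaffian_orientation_def orientation_def)
  ultimately show ?thesis using arc_iff_less[of j i] assms adj_commute by auto
qed

text \<open>By \<open>arc_iff\<close>, forward arcs and ascents of the cycle differ by the number of
  edges whose ends have different \<open>switch\<close> values. This number is even, as every vertex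
  contributes its value twice around the cycle.\<close>

lemma odd_ascents:
  assumes "distinct is" "set is \<subseteq> {..<n}" "3 \<le> length is"
    and a: "\<And>k. k < length is \<Longrightarrow> adj (is ! k) (is ! (Suc k mod length is))"
    and \<mu>: "\<And>i. i < n \<Longrightarrow> i \<notin> set is \<Longrightarrow> \<mu> i < n \<and> \<mu> i \<notin> set is \<and> adj i (\<mu> i) \<and> \<mu> (\<mu> i) = i"
  shows "odd (\<Sum>k<length is. of_bool (is ! k < is ! (Suc k mod length is)) :: nat)"
proof -
  let ?l = "length is"
  let ?b = "\<lambda>k. (hs ! (is ! k), hs ! (is ! (Suc k mod ?l))) \<in> A"
  let ?s = "\<lambda>k. switch (is ! k)"
  have l: "Suc k mod ?l < ?l" for k using assms(3) by (intro mod_less_divisor) auto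
  have *: "?b k \<longleftrightarrow> ((is ! k < is ! (Suc k mod ?l)) \<noteq> (?s k \<noteq> ?s (Suc k mod ?l)))"
    if "k < ?l" for k
    using arc_iff[OF _ _ a[OF that]] assms(2) that l[of k] by (auto simp: subset_iff)
  have "even (\<Sum>k<?l. of_bool (?b k) + of_bool (is ! k < is ! (Suc k mod ?l)) +
      of_bool (?s k) + of_bool (?s (Suc k mod ?l)) :: nat)"
    by (rule dvd_sum) (use * in auto)
  then have "even ((\<Sum>k<?l. of_bool (?b k)) + (\<Sum>k<?l. of_bool (is ! k < is ! (Suc k mod ?l))) +
      (\<Sum>k<?l. of_bool (?s k)) + (\<Sum>k<?l. of_bool (?s k)) :: nat)"
    using sum_Suc_mod[of "\<lambda>k. of_bool (?s k)" ?l] by (simp add: sum.distrib)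
  moreover have "odd (\<Sum>k<?l. of_bool (?b k) :: nat)"
    by (rule odd_forward_arcs[OF assms(1,2) central_cycle_indices[OF assms]])
  ultimately show ?thesis by auto
qed

text \<open>\<open>U\<close> stands for the vertex set of the component of 0. A cycle outside it is
  central but meets only even positions with one lower and one higher neighbour, so its ascents come
  in pairs, against \<open>odd_ascents\<close>.\<close>

lemma two_factor_hamiltonian:
  assumes reg: "two_regular {..<n} nb"
    and nb_adj: "\<And>i j. i < n \<Longrightarrow> j \<in> nb i \<Longrightarrow> adj i j"
    and straddle: "\<And>y x z. even y \<Longrightarrow> 0 < y \<Longrightarrow> y < n \<Longrightarrow> x \<in> nb y \<Longrightarrow> z \<in> nb y \<Longrightarrow> x \<noteq> z \<Longrightarrow>
      x < y \<longleftrightarrow> y < z"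
    and closed: "\<And>v. v \<in> U \<Longrightarrow> nb v \<subseteq> U" and U: "0 \<in> U" "U \<subseteq> {..<n}"
  shows "U = {..<n}"
proof (rule ccontr)
  assume "U \<noteq> {..<n}"
  then obtain v where v: "v < n" "v \<notin> U" using U by auto
  have bound: "\<And>i j. i < n \<Longrightarrow> j \<in> nb i \<Longrightarrow> j < n" and sym: "\<And>i j. i < n \<Longrightarrow> j \<in> nb i \<Longrightarrow> i \<in> nb j"
    and two: "\<And>i. i < n \<Longrightarrow> card (nb i) = 2"
    using reg by (auto simp: two_regular_def)
  have par: "odd i \<longleftrightarrow> even j" if "i < n" "j \<in> nb i" for i j
    using parity(2)[OF that(1) bound[OF that] nb_adj[OF that]] .
  have ne: "\<exists>j. j \<in> nb i" if "i < n" for i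
    using two[OF that] by (metis card.empty ex_in_conv zero_neq_numeral)
  define W where "W = {..<n} - U"
  have regW: "two_regular W nb"
    unfolding W_def by (rule two_regular_Diff[OF reg closed])
  have "\<exists>x\<in>W. odd x"
  proof (cases "odd v")
    case True
    then show ?thesis using v by (auto simp: W_def)
  next
    case False
    obtain j where j: "j \<in> nb v" using ne v by blast
    moreover have "j \<in> W" using regW j v by (auto simp: two_regular_def W_def)
    ultimately show ?thesis using par[of v j] v False by blast
  qed
  \<comment> \<open>Starting at an odd position puts the even positions at odd indices. Then the
    terms \<open>2 * t\<close> and \<open>Suc (2 * t)\<close> of the ascent sum belong to the two
    edges at one even position.\<close>
  then obtain x where x: "x \<in> W" "odd x" by blast
  obtain w where w: "w \<in> nb x" using ne x by (auto simp: W_def)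
  obtain us where us: "distinct us" "set us \<subseteq> W" "3 \<le> length us" "us ! 0 = x"
    and nb_us: "\<And>i. i < length us \<Longrightarrow>
      nb (us ! (Suc i mod length us)) = {us ! i, us ! (Suc (Suc i) mod length us)}"
    using two_regular_cycle[OF regW x(1) w] by metis
  have cyc: "nb (us ! j) \<subseteq> set us" "us ! (Suc j mod length us) \<in> nb (us ! j)"
    if "j < length us" for j
    using two_regular_cycle_nb[of us nb j] us(3) nb_us that by blast+
  have lt: "us ! j < n" if "j < length us" for j
    using subsetD[OF us(2) nth_mem[OF that]] by (simp add: W_def)
  have col: "odd (us ! i) \<noteq> odd (us ! (Suc i mod length us))" if "i < length us" for i
    using par[OF lt cyc(2)] that by blast
  have alt: "odd (us ! i) \<longleftrightarrow> even i" if "i < length us" for i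
    using alternating_colours(1)[of us odd i] us(3,4) x(2) col that by blast
  have "even (length us)"
    using alternating_colours(2)[of us odd] us(3) col by blast
  then obtain h where h: "length us = 2 * h" by (elim evenE)
  \<comment> \<open>Centrality: all vertices off this one cycle, those of \<open>U\<close> included,
    induce even cycles of \<open>nb\<close> and can be matched along them.\<close>
  have "two_regular ({..<n} - set us) nb"
    by (rule two_regular_Diff[OF reg]) (use cyc(1) in \<open>auto simp: in_set_conv_nth\<close>)
  then obtain \<mu> where \<mu>: "\<forall>i\<in>{..<n} - set us. \<mu> i \<in> nb i \<and> \<mu> i \<in> {..<n} - set us \<and> \<mu> (\<mu> i) = i"
    using two_regular_matching[of "{..<n} - set us" nb odd] par by auto
  have "odd (\<Sum>k<length us. of_bool (us ! k < us ! (Suc k mod length us)) :: nat)"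
  proof (rule odd_ascents[where \<mu> = \<mu>])
    show "adj (us ! k) (us ! (Suc k mod length us))" if "k < length us" for k
      using nb_adj[OF lt cyc(2)] that by blast
  qed (use us \<mu> nb_adj in \<open>auto simp: W_def\<close>)
  moreover have "even (\<Sum>k<2 * h. of_bool (us ! k < us ! (Suc k mod length us)) :: nat)"
  proof (rule even_sum_pairs)
    fix t assume "t < h"
    then have t: "Suc (2 * t) < length us" using h by linarith
    let ?y = "us ! Suc (2 * t)" and ?z = "us ! (Suc (Suc (2 * t)) mod length us)"
    have nb: "nb ?y = {us ! (2 * t), ?z}" using nb_us[of "2 * t"] t by simp
    have y: "?y < n" "even ?y" using lt[OF t] alt[OF t] by auto
    have "?y \<notin> U" using subsetD[OF us(2) nth_mem[OF t]] by (simp add: W_def)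
    then have "0 < ?y" using U(1) by (metis neq0_conv)
    moreover have "us ! (2 * t) \<noteq> ?z" using two[OF y(1)] nb by auto
    ultimately have "us ! (2 * t) < ?y \<longleftrightarrow> ?y < ?z"
      using straddle[OF y(2) _ y(1)] nb by auto
    then show "us ! (2 * t) < us ! (Suc (2 * t) mod length us) \<longleftrightarrow>
        us ! Suc (2 * t) < us ! (Suc (Suc (2 * t)) mod length us)"
      using t by simp
  qed
  ultimately show False using h by simp
qed

end


section \<open>Exchanging chords\<close>

text \<open>\<open>pb\<close> is the position of the other end of the anchor edge and
  \<open>z\<close> the other neighbour of position 0 on the cycle. The distance bounds exclude
  exactly the edges of the cycle; the distance is written with truncated subtraction, as the machine
  computes it.\<close>

locale chord_choice = hamiltonian_pfaffian +
  fixes Ch :: "nat \<Rightarrow> nat" and pb z :: nat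
  assumes chord: "\<And>i. i < n \<Longrightarrow> Ch i < n \<and> adj i (Ch i) \<and>
      1 < (i - Ch i) + (Ch i - i) \<and> (i - Ch i) + (Ch i - i) < n - 1"
    and ends: "pb = 1 \<and> z = n - 1 \<or> pb = n - 1 \<and> z = 1"
begin

lemma n4: "4 \<le> n" "even n"
proof -
  have "n \<noteq> 3" using parity(1) by auto
  then show "4 \<le> n" using n3 by linarith
qed (rule parity(1))

definition lft :: "nat \<Rightarrow> nat" where "lft v = (if v = 0 then n - 1 else v - 1)"
definition rgt :: "nat \<Rightarrow> nat" where "rgt v = (if Suc v = n then 0 else Suc v)"

lemma lft_rgt:
  assumes "v < n"
  shows "lft v < n" "rgt v < n" "lft v \<noteq> rgt v" "lft (rgt v) = v" "rgt (lft v) = v"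
    "odd (lft v) \<longleftrightarrow> even v" "odd (rgt v) \<longleftrightarrow> even v" "adj v (lft v)" "adj v (rgt v)"
proof -
  show "lft v < n" "rgt v < n" "lft v \<noteq> rgt v" "lft (rgt v) = v" "rgt (lft v) = v"
    using assms n4(1) by (auto simp: lft_def rgt_def)
  show "odd (lft v) \<longleftrightarrow> even v" "odd (rgt v) \<longleftrightarrow> even v"
  proof -
    have "Suc v = n \<Longrightarrow> odd v" using n4(2) by (metis even_Suc)
    then show "odd (lft v) \<longleftrightarrow> even v" "odd (rgt v) \<longleftrightarrow> even v"
      using n4 by (auto simp: lft_def rgt_def)
  qed
  show "adj v (rgt v)"
    using adj_Suc_mod[OF assms] assms by (auto simp: rgt_def)
  show "adj v (lft v)"
    using adj_Suc_mod[of "lft v"] assms n4(1)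
    by (cases v) (auto simp: lft_def insert_commute)
qed

lemma chord_not_nb: "i < n \<Longrightarrow> Ch i \<noteq> lft i \<and> Ch i \<noteq> rgt i \<and> i \<noteq> lft (Ch i) \<and> i \<noteq> rgt (Ch i)"
proof -
  assume i: "i < n"
  have c: "Ch i < n" "1 < (i - Ch i) + (Ch i - i)" "(i - Ch i) + (Ch i - i) < n - 1"
    using chord[OF i] by blast+
  show ?thesis
    unfolding lft_def rgt_def by (intro conjI; split if_split; use c i in linarith)
qed

text \<open>If the chord at \<open>u\<close> is put into the cycle, then the edge from \<open>Ch u\<close> to \<open>shift u\<close> is taken
  out.  It lies on the same side of \<open>Ch u\<close> as the chord, except that the anchor edge at position
  \<open>0\<close> is spared.\<close>

definition shift :: "nat \<Rightarrow> nat" where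
  "shift u = (if 0 < Ch u then if u < Ch u then Ch u - 1 else Ch u + 1 else z)"

lemma odd_chord: "u < n \<Longrightarrow> odd (Ch u) \<longleftrightarrow> even u"
  using chord[of u] parity(2)[of u "Ch u"] by blast

lemma shift_props:
  assumes "u < n" "odd u"
  shows "shift u < n" "odd (shift u)" "shift u = lft (Ch u) \<or> shift u = rgt (Ch u)"
    "Ch u = lft (shift u) \<or> Ch u = rgt (shift u)"
    "0 < Ch u \<Longrightarrow> shift u < Ch u \<longleftrightarrow> u < Ch u"
proof -
  have c: "Ch u < n" "even (Ch u)" using chord[OF assms(1)] odd_chord[OF assms(1)] assms(2) by auto
  \<comment> \<open>An even position is not the last one, so \<open>Ch u + 1\<close> does not wrap
    around.\<close>
  then have "Suc (Ch u) < n" using n4(2) by (metis Suc_lessI even_Suc)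
  then show *: "shift u = lft (Ch u) \<or> shift u = rgt (Ch u)"
    using ends n4 by (auto simp: shift_def lft_def rgt_def)
  show "shift u < n" "odd (shift u)" "Ch u = lft (shift u) \<or> Ch u = rgt (shift u)"
    using * lft_rgt[OF c(1)] c(2) by auto
  show "shift u < Ch u \<longleftrightarrow> u < Ch u" if "0 < Ch u"
    using that by (auto simp: shift_def)
qed

section \<open>A cycle of the shift\<close>

definition start :: nat where "start = (shift ^^ n) 1"

lemma shift_pow: "(shift ^^ i) 1 < n \<and> odd ((shift ^^ i) 1)"
  using n4 shift_props by (induction i) auto

lemma start_pow: "(shift ^^ i) start < n \<and> odd ((shift ^^ i) start)"
  unfolding start_def by (metis comp_apply funpow_add shift_pow)

text \<open>Two of the iterates 0, ..., \<open>n\<close> of 1 coincide, say at indices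
  \<open>i < j\<close>. From index \<open>i\<close> on the walk repeats after \<open>j - i\<close>
  steps, and \<open>n\<close> is at least \<open>i\<close>.\<close>

lemma periodic: "\<exists>k>0. (shift ^^ k) start = start"
proof -
  have "\<not> inj_on (\<lambda>i. (shift ^^ i) 1) {..n}"
  proof
    assume "inj_on (\<lambda>i. (shift ^^ i) 1) {..n}"
    moreover have "(\<lambda>i. (shift ^^ i) 1) ` {..n} \<subseteq> {..<n}" using shift_pow by auto
    ultimately have "card {..n} \<le> card {..<n}" by (metis card_inj_on_le finite_lessThan)
    then show False by simp
  qed
  then obtain i j where ij: "i < j" "j \<le> n" "(shift ^^ i) 1 = (shift ^^ j) 1"
    unfolding inj_on_def by (metis atMost_iff linorder_neqE_nat)
  have add: "(shift ^^ (p + q)) x = (shift ^^ p) ((shift ^^ q) x)" for p q x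
    by (simp add: funpow_add)
  have eq: "j - i + n = (n - i) + j" "n = (n - i) + i" using ij by simp_all
  have "(shift ^^ (j - i)) start = (shift ^^ (j - i + n)) 1"
    unfolding start_def add ..
  moreover have "(shift ^^ (j - i + n)) 1 = (shift ^^ (n - i)) ((shift ^^ j) 1)"
    by (subst eq(1)) (rule add)
  moreover have "start = (shift ^^ (n - i)) ((shift ^^ i) 1)"
    unfolding start_def by (subst eq(2)) (rule add)
  ultimately have "(shift ^^ (j - i)) start = start" using ij(3) by simp
  moreover have "0 < j - i" using ij(1) by simp
  ultimately show ?thesis by blast
qed

definition period :: nat where "period = (LEAST k. 0 < k \<and> (shift ^^ k) start = start)"

lemma period: "0 < period" "(shift ^^ period) start = start"
  "\<And>k. 0 < k \<Longrightarrow> k < period \<Longrightarrow> (shift ^^ k) start \<noteq> start"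
  using LeastI_ex[OF periodic] not_less_Least[of _ "\<lambda>k. 0 < k \<and> (shift ^^ k) start = start"]
  unfolding period_def by auto

text \<open>A collision at \<open>i < j\<close>, continued for \<open>period - j\<close> steps,
  would return to \<open>start\<close> before \<open>period\<close>. The index 0 is left out because
  it agrees with \<open>period\<close>.\<close>

lemma pow_inj:
  assumes "i < j" "j \<le> period" "0 < i"
  shows "(shift ^^ i) start \<noteq> (shift ^^ j) start"
proof
  assume *: "(shift ^^ i) start = (shift ^^ j) start"
  have "(shift ^^ (period - j + i)) start = (shift ^^ (period - j)) ((shift ^^ i) start)"
    by (simp add: funpow_add)
  also have "\<dots> = (shift ^^ (period - j + j)) start"
    unfolding * by (simp add: funpow_add)
  also have "\<dots> = (shift ^^ period) start" using assms(2) by simp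
  finally have "(shift ^^ (period - j + i)) start = start" unfolding period(2) .
  moreover have "0 < period - j + i" "period - j + i < period" using assms by simp_all
  ultimately show False using period(3)[of "period - j + i"] by simp
qed

text \<open>The odd vertices that have lost an edge during the first \<open>t\<close> exchanges.
  Exchange \<open>i\<close> takes the edge from iterate \<open>Suc i\<close>, hence the
  offset.\<close>

definition cyc :: "nat \<Rightarrow> nat set" where "cyc t = (\<lambda>i. (shift ^^ Suc i) start) ` {..<t}"

lemma cyc_0 [simp]: "cyc 0 = {}" by (simp add: cyc_def)

lemma cyc_Suc: "cyc (Suc t) = insert (shift ((shift ^^ t) start)) (cyc t)"
  by (auto simp: cyc_def lessThan_Suc)

lemma cyc_fresh: "t < period \<Longrightarrow> shift ((shift ^^ t) start) \<notin> cyc t"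
  using pow_inj[of _ "Suc t"] by (force simp: cyc_def)

abbreviation C :: "nat set" where "C \<equiv> cyc period"

lemma cyc_subset: "t \<le> period \<Longrightarrow> cyc t \<subseteq> C"
  by (auto simp: cyc_def)

lemma C_props: "u \<in> C \<Longrightarrow> u < n \<and> odd u"
  using start_pow[of "Suc _"] by (auto simp: cyc_def simp del: funpow.simps)

lemma start_in_C: "start \<in> C"
  using period(1,2) unfolding cyc_def
  by (intro image_eqI[of _ _ "period - 1"]) auto

lemma pow_in_C: "(shift ^^ t) start \<in> C" if "t < period" for t
proof (cases t)
  case 0
  then show ?thesis using start_in_C by simp
next
  case (Suc s)
  then show ?thesis using that by (auto simp: cyc_def)
qed

lemma shift_image_C: "shift ` C = C"
proof
  show "shift ` C \<subseteq> C"
  proof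
    fix x assume "x \<in> shift ` C"
    then obtain i where i: "i < period" "x = shift ((shift ^^ Suc i) start)" by (auto simp: cyc_def)
    show "x \<in> C"
    proof (cases "Suc i = period")
      case True
      then show ?thesis using i period
        by (auto simp: cyc_def intro!: image_eqI[of _ _ 0])
    next
      case False
      then show ?thesis using i by (auto simp: cyc_def intro!: image_eqI[of _ _ "Suc i"])
    qed
  qed
  show "C \<subseteq> shift ` C"
    using pow_in_C by (auto simp: cyc_def[of period])
qed

definition prev :: "nat \<Rightarrow> nat" where "prev = inv_into C shift"

text \<open>The shift maps the finite set \<open>C\<close> onto itself, so it is injective there
  even if it is not elsewhere. Every vertex of \<open>C\<close> therefore loses just one
  edge.\<close>

lemma prev: "x \<in> C \<Longrightarrow> prev x \<in> C" "x \<in> C \<Longrightarrow> shift (prev x) = x" "u \<in> C \<Longrightarrow> prev (shift u) = u"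
proof -
  have fin: "finite C" by (simp add: cyc_def)
  have inj: "inj_on shift C"
    using shift_image_C by (intro eq_card_imp_inj_on fin) simp
  show "x \<in> C \<Longrightarrow> prev x \<in> C" "x \<in> C \<Longrightarrow> shift (prev x) = x"
    unfolding prev_def using shift_image_C by (metis inv_into_into, metis f_inv_into_f)
  show "u \<in> C \<Longrightarrow> prev (shift u) = u"
    unfolding prev_def using inj by simp
qed

text \<open>\<open>repl D v w\<close> is the vertex that replaces the neighbour \<open>w\<close> of \<open>v\<close> on the given cycle once every
  odd vertex in \<open>D\<close> has lost its edge to the chord of its predecessor and received its own chord.\<close>

definition repl :: "nat set \<Rightarrow> nat \<Rightarrow> nat \<Rightarrow> nat" where
  "repl D v w =
     (if even v then if w \<in> D \<and> Ch (prev w) = v then prev w else w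
      else if v \<in> D \<and> Ch (prev v) = w then Ch v else w)"

definition nbsum :: "nat set \<Rightarrow> nat \<Rightarrow> nat" where
  "nbsum D v = repl D v (lft v) + repl D v (rgt v)"

definition nb :: "nat \<Rightarrow> nat set" where
  "nb v = {repl C v (lft v), repl C v (rgt v)}"

lemma nbsum_empty: "nbsum {} v = lft v + rgt v"
  by (simp add: nbsum_def repl_def)

text \<open>One exchange replaces \<open>shift u\<close> by \<open>u\<close> at \<open>Ch u\<close>,
  and \<open>Ch u\<close> by \<open>Ch (shift u)\<close> at \<open>shift u\<close>. The last two
  inequalities make the truncated subtractions exact. Halfway through, the neighbourhoods need not
  be symmetric: a chord is entered at its odd end one exchange before its even end, while the chord
  of \<open>start\<close> gets its odd end only in the last exchange.\<close>

lemma nbsum_insert: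
  assumes u: "u \<in> C" and o: "shift u \<notin> D" and v: "v < n"
  shows "nbsum (insert (shift u) D) v =
      (if v = shift u then nbsum D v - Ch u + Ch (shift u)
       else if v = Ch u then nbsum D v - shift u + u else nbsum D v)"
    and "Ch u \<le> nbsum D (shift u)" "shift u \<le> nbsum D (Ch u)"
proof -
  let ?o = "shift u" and ?y = "Ch u"
  note un = C_props[OF u]
  have o_odd: "odd ?o" and o_n: "?o < n" and y_even: "even ?y" and y_n: "?y < n"
    using shift_props[of u] un odd_chord[of u] chord[of u] by auto
  have pr: "prev ?o = u" using prev(3) u by simp
  have nby: "?o = lft ?y \<or> ?o = rgt ?y" and nbo: "?y = lft ?o \<or> ?y = rgt ?o"
    using shift_props un by auto
  have lr: "lft ?y \<noteq> rgt ?y" "lft ?o \<noteq> rgt ?o" using lft_rgt(3) o_n y_n by auto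
  have yo: "?y \<noteq> ?o" using o_odd y_even by auto
  have a: "repl D ?y ?o = ?o" "repl D ?o ?y = ?y" "repl (insert ?o D) ?y ?o = u"
    "repl (insert ?o D) ?o ?y = Ch ?o"
    using o o_odd y_even pr by (simp_all add: repl_def)
  have b: "repl (insert ?o D) v w = repl D v w" if "v \<noteq> ?y \<or> w \<noteq> ?o" "v \<noteq> ?o \<or> w \<noteq> ?y" for v w
    using that o pr by (auto simp: repl_def)
  show "?y \<le> nbsum D ?o" using nbo a by (auto simp: nbsum_def)
  show "?o \<le> nbsum D ?y" using nby a by (auto simp: nbsum_def)
  have "nbsum (insert ?o D) ?o = nbsum D ?o - ?y + Ch ?o"
    using nbo lr a b[of ?o] yo by (auto simp: nbsum_def)
  moreover have "nbsum (insert ?o D) ?y = nbsum D ?y - ?o + u"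
    using nby lr a b[of ?y] yo by (auto simp: nbsum_def)
  moreover have "nbsum (insert ?o D) v = nbsum D v" if "v \<noteq> ?o" "v \<noteq> ?y"
    using that b[of v] by (simp add: nbsum_def)
  ultimately show "nbsum (insert ?o D) v = (if v = ?o then nbsum D v - ?y + Ch ?o
       else if v = ?y then nbsum D v - ?o + u else nbsum D v)" by auto
qed

section \<open>The 2-regular graph after all exchanges\<close>

lemma repl_even_cases:
  assumes "even v"
  obtains (keep) "\<not> (w \<in> C \<and> Ch (prev w) = v)" "repl C v w = w"
    | (exchange) u where "u \<in> C" "Ch u = v" "shift u = w" "repl C v w = u" "w \<in> C"
  using assms prev by (cases "w \<in> C \<and> Ch (prev w) = v") (auto simp: repl_def)

lemma repl_adj:
  assumes "v < n" "w = lft v \<or> w = rgt v"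
  shows "adj v (repl C v w) \<and> repl C v w < n"
proof -
  have w: "w < n" "adj v w" using lft_rgt[OF assms(1)] assms(2) by auto
  show ?thesis
  proof (cases "even v")
    case True
    then show ?thesis
    proof (cases rule: repl_even_cases[of v w])
      case keep
      then show ?thesis using w by simp
    next
      case (exchange u)
      then show ?thesis using C_props[of u] chord[of u] adj_commute[of u v] by auto
    qed
  next
    case False
    then show ?thesis using w chord[OF assms(1)] by (simp add: repl_def)
  qed
qed

lemma mem_nb_iff: "x \<in> nb v \<longleftrightarrow> (\<exists>w. (w = lft v \<or> w = rgt v) \<and> x = repl C v w)"
  by (auto simp: nb_def)

text \<open>A chord never joins neighbours on the cycle, so an exchanged neighbour differs from a
  kept one. Two exchanged neighbours \<open>u\<close> and \<open>u'\<close> of an even vertex have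
  different shifts.\<close>

lemma repl_lft_rgt:
  assumes v: "v < n"
  shows "repl C v (lft v) \<noteq> repl C v (rgt v)"
proof (cases "even v")
  case True
  have *: "repl C v w \<noteq> w'"
    if "w \<noteq> w'" "w = lft v \<and> w' = rgt v \<or> w = rgt v \<and> w' = lft v" for w w'
    using True
  proof (cases rule: repl_even_cases[of v w])
    case keep
    then show ?thesis using that by simp
  next
    case (exchange u)
    then show ?thesis
      using chord_not_nb[of u] C_props[of u] that by auto
  qed
  show ?thesis
    using True
  proof (cases rule: repl_even_cases[of v "lft v"])
    case keep
    then show ?thesis using *[of "rgt v" "lft v"] lft_rgt(3)[OF v] by auto
  next
    case (exchange u)
    note u = this
    show ?thesis
      using True
    proof (cases rule: repl_even_cases[of v "rgt v"])
      case keep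
      then show ?thesis using *[of "lft v" "rgt v"] lft_rgt(3)[OF v] by auto
    next
      case (exchange u')
      then show ?thesis using u lft_rgt(3)[OF v] by auto
    qed
  qed
next
  case False
  then show ?thesis
    using lft_rgt(3)[OF v] chord_not_nb[OF v] by (auto simp: repl_def)
qed

text \<open>The chord of \<open>u\<close> in \<open>C\<close> is present at both ends: at
  \<open>u\<close> it fills the place of the lost neighbour \<open>Ch (prev u)\<close>, and at
  \<open>Ch u\<close> it fills the place of \<open>shift u\<close>. A removed edge vanishes from
  both ends under the same condition.\<close>

lemma nb_symmetric:
  assumes v: "v < n" and x: "x \<in> nb v"
  shows "v \<in> nb x"
proof -
  obtain w where w: "w = lft v \<or> w = rgt v" "x = repl C v w" using x mem_nb_iff by blast
  have vw: "v = lft w \<or> v = rgt w" "odd w \<longleftrightarrow> even v" "w < n" using w lft_rgt[OF v] by auto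
  show ?thesis
  proof (cases "even v")
    case True
    then show ?thesis
    proof (cases rule: repl_even_cases[of v w])
      case keep
      then have "repl C w v = v" using vw True by (auto simp: repl_def)
      then show ?thesis using keep w vw mem_nb_iff by metis
    next
      case (exchange u)
      define y where "y = Ch (prev u)"
      have p: "prev u \<in> C" "shift (prev u) = u" using prev exchange by auto
      then have "y = lft u \<or> y = rgt u" unfolding y_def
        using shift_props(4)[of "prev u"] C_props[of "prev u"] by auto
      moreover have "repl C u y = v"
        using exchange C_props[of u] by (simp add: repl_def y_def)
      ultimately show ?thesis using exchange w mem_nb_iff by metis
    qed
  next
    case False
    show ?thesis
    proof (cases "v \<in> C \<and> Ch (prev v) = w")
      case True
      define o' where "o' = shift v"
      have xv: "x = Ch v" using True w False by (simp add: repl_def)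
      have o: "o' \<in> C" "prev o' = v"
        using True shift_image_C prev(3) by (auto simp: o'_def)
      have "o' = lft x \<or> o' = rgt x" using shift_props(3)[of v] v False xv by (simp add: o'_def)
      moreover have "repl C x o' = v"
        using o xv odd_chord[OF v] False by (simp add: repl_def)
      ultimately show ?thesis using mem_nb_iff by metis
    next
      case nexch: False
      then have "x = w" "repl C w v = v" using w vw False by (auto simp: repl_def)
      then show ?thesis using vw mem_nb_iff by metis
    qed
  qed
qed

lemma two_regular_nb: "two_regular {..<n} nb"
  unfolding two_regular_def
proof (intro conjI ballI)
  fix v assume "v \<in> {..<n}"
  then have v: "v < n" by simp
  show "card (nb v) = 2" using repl_lft_rgt[OF v] by (simp add: nb_def)
  show "nb v \<subseteq> {..<n}" using repl_adj[OF v] by (auto simp: nb_def)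
  show "v \<notin> nb v" using repl_adj[OF v] not_adj_refl[of v] by (metis mem_nb_iff)
  show "v \<in> nb w" if "w \<in> nb v" for w using nb_symmetric[OF v that] .
qed simp

text \<open>The removed edge lies on the same side of \<open>y\<close> as the chord that replaces
  it, so each replacement stays on the side of the old neighbour. In the original cycle an even
  \<open>y > 0\<close> has one neighbour on each side.\<close>

lemma nb_straddle:
  assumes y: "even y" "0 < y" "y < n" and x: "x \<in> nb y" and x': "x' \<in> nb y" and ne: "x \<noteq> x'"
  shows "x < y \<longleftrightarrow> y < x'"
proof -
  have side: "repl C y w < y \<longleftrightarrow> w < y" for w
    using y(1)
  proof (cases rule: repl_even_cases[of y w])
    case (exchange u)
    then show ?thesis using shift_props(5)[of u] C_props[of u] y(2) by auto
  qed simp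
  have "Suc y < n" using y n4(2) by (metis Suc_lessI even_Suc)
  then have "lft y < y" "\<not> rgt y < y" using y by (auto simp: lft_def rgt_def)
  then have "repl C y (lft y) < y" "\<not> repl C y (rgt y) < y" using side by auto
  moreover have "repl C y (rgt y) \<noteq> y"
    using repl_adj[OF y(3)] not_adj_refl by metis
  ultimately show ?thesis using x x' ne by (auto simp: nb_def)
qed

text \<open>The only edge of position 0 that is ever taken out leads to \<open>z\<close>, and
  \<open>z\<close> is not \<open>pb\<close>.\<close>

lemma anchor_nb: "pb \<in> nb 0"
proof -
  have "pb = lft 0 \<or> pb = rgt 0" using ends n4 by (auto simp: lft_def rgt_def)
  moreover have "repl C 0 pb = pb"
  proof (rule repl_even_cases[of 0 pb])
    fix u assume "Ch u = 0" "shift u = pb"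
    then have "pb = z" by (simp add: shift_def)
    then show ?thesis using ends n4 by auto
  qed simp_all
  ultimately show ?thesis using mem_nb_iff by metis
qed

lemma chord_nb: "u \<in> C \<Longrightarrow> Ch u \<in> nb u"
proof -
  assume u: "u \<in> C"
  define y where "y = Ch (prev u)"
  have "y = lft u \<or> y = rgt u" unfolding y_def
    using shift_props(4)[of "prev u"] prev u C_props[of "prev u"] by auto
  moreover have "repl C u y = Ch u"
    using u C_props[of u] by (simp add: repl_def y_def)
  ultimately show ?thesis using mem_nb_iff by metis
qed

text \<open>The traversal leaves 0 through the anchor edge, so the trace knows its first two
  positions without choosing a direction. The equations for \<open>nbsum\<close> are what lets the
  machine continue from them.\<close>

lemma new_cycle:
  obtains vs where "length vs = n" "distinct vs" "set vs = {..<n}" "vs ! 0 = 0" "vs ! 1 = pb"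
    "\<And>i. i < n \<Longrightarrow> nbsum C (vs ! (Suc i mod n)) = vs ! i + vs ! (Suc (Suc i) mod n)"
    "hamiltonian_cycle V E (map ((!) hs) vs)"
    "cycle_edges (map ((!) hs) vs) \<noteq> cycle_edges hs"
    "{hs ! 0, hs ! pb} \<in> cycle_edges (map ((!) hs) vs)"
proof -
  have n0: "0 < n" "1 < n" using n4 by auto
  have nb_adj: "adj i j" if "i < n" "j \<in> nb i" for i j
    using repl_adj[OF that(1)] that(2) mem_nb_iff by auto
  obtain vs where vs: "distinct vs" "set vs \<subseteq> {..<n}" "3 \<le> length vs" "vs ! 0 = 0" "vs ! 1 = pb"
    and nb_vs: "\<And>i. i < length vs \<Longrightarrow>
      nb (vs ! (Suc i mod length vs)) = {vs ! i, vs ! (Suc (Suc i) mod length vs)}"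
    using two_regular_cycle[OF two_regular_nb _ anchor_nb] n0 by auto
  have cl: "nb (vs ! j) \<subseteq> set vs" "vs ! (Suc j mod length vs) \<in> nb (vs ! j)"
    if "j < length vs" for j
    using two_regular_cycle_nb[of vs nb j] vs(3) nb_vs that by blast+
  have all: "set vs = {..<n}"
  proof (rule two_factor_hamiltonian[OF two_regular_nb nb_adj])
    show "0 \<in> set vs" using vs(3,4) nth_mem[of 0 vs] by fastforce
    show "nb v \<subseteq> set vs" if "v \<in> set vs" for v using that cl by (auto simp: in_set_conv_nth)
  qed (use nb_straddle vs in auto)
  have len: "length vs = n" using distinct_card[OF vs(1)] all by simp
  have lt: "vs ! i < n" if "i < n" for i using subsetD[OF vs(2) nth_mem[of i vs]] len that by simp
  have sum: "nbsum C (vs ! (Suc i mod n)) = vs ! i + vs ! (Suc (Suc i) mod n)" if i: "i < n" for i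
  proof -
    let ?v = "vs ! (Suc i mod n)"
    have v: "?v < n" using lt n0 by simp
    have "{repl C ?v (lft ?v), repl C ?v (rgt ?v)} = {vs ! i, vs ! (Suc (Suc i) mod n)}"
      using nb_vs[of i] i len by (simp add: nb_def)
    then show ?thesis by (auto simp: nbsum_def doubleton_eq_iff)
  qed
  have map_nth: "map ((!) hs) vs ! k = hs ! (vs ! k)" "Suc k mod n < n"
     if "k < n" for k using that len n0 by auto
  have edges: "cycle_edges (map ((!) hs) vs) =
      (\<lambda>k. {hs ! (vs ! k), hs ! (vs ! (Suc k mod n))}) ` {..<n}"
  proof -
    have "cycle_edges (map ((!) hs) vs) =
        (\<lambda>k. {map ((!) hs) vs ! k, map ((!) hs) vs ! (Suc k mod n)}) ` {..<n}"
      by (simp only: cycle_edges_eq setcompr_eq_image length_map len lessThan_def)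
    also have "\<dots> = (\<lambda>k. {hs ! (vs ! k), hs ! (vs ! (Suc k mod n))}) ` {..<n}"
      by (rule image_cong) (use map_nth in auto)
    finally show ?thesis .
  qed
  have ham': "hamiltonian_cycle V E (map ((!) hs) vs)"
    unfolding hamiltonian_cycle_def
  proof
    show "is_cycle V E (map ((!) hs) vs)"
    proof (rule is_cycle_indices)
      show "adj (vs ! k) (vs ! (Suc k mod length vs))" if "k < length vs" for k
        using nb_adj[OF lt cl(2)] that len by simp
    qed (use vs in auto)
    show "set (map ((!) hs) vs) = V"
      unfolding set_map all set_hs[symmetric] by (auto simp: set_conv_nth)
  qed
  have "{hs ! 0, hs ! pb} \<in> cycle_edges (map ((!) hs) vs)"
    unfolding edges using vs(4,5) n0 by (intro image_eqI[of _ _ 0]) auto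
  moreover have "cycle_edges (map ((!) hs) vs) \<noteq> cycle_edges hs"
  proof
    assume eq: "cycle_edges (map ((!) hs) vs) = cycle_edges hs"
    \<comment> \<open>The chord at \<open>start\<close> is in the new cycle but, being a chord, not
      in the old one.\<close>
    have s: "start < n" using C_props start_in_C by blast
    then have "start \<in> set vs" using all by simp
    then obtain j where j: "j < n" "vs ! j = start" using len by (auto simp: in_set_conv_nth)
    obtain i where i: "i < n" "Suc i mod n = j"
    proof (cases j)
      case 0
      then show ?thesis using that[of "n - 1"] n0 by simp
    next
      case (Suc j')
      then show ?thesis using that[of j'] j by simp
    qed
    have "Suc (Suc i) mod n = Suc j mod n" using i(2) by (metis mod_Suc_eq)
    then have "Ch start \<in> {vs ! i, vs ! (Suc j mod n)}"
      using chord_nb[OF start_in_C] nb_vs[of i] i j len by auto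
    then have "{hs ! start, hs ! Ch start} \<in> cycle_edges (map ((!) hs) vs)"
    proof
      assume "Ch start = vs ! i"
      then show ?thesis unfolding edges using i j by (intro image_eqI[of _ _ i]) auto
    next
      assume "Ch start \<in> {vs ! (Suc j mod n)}"
      then show ?thesis unfolding edges using j by (intro image_eqI[of _ _ j]) auto
    qed
    then obtain k where k: "k < n" "{hs ! start, hs ! Ch start} = {hs ! k, hs ! (Suc k mod n)}"
      unfolding eq by (auto simp: cycle_edges_eq)
    have "Suc k mod n = rgt k" "k = lft (rgt k)" "rgt k < n"
      using k n0 lft_rgt by (auto simp: rgt_def)
    then show False
      using k hs_eq_iff s chord[OF s] chord_not_nb[OF s] by (auto simp: doubleton_eq_iff)
  qed
  ultimately show ?thesis using that[OF len vs(1) all vs(4,5) sum ham'] by blast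
qed

end


section \<open>The algorithm\<close>

text \<open>
  Behind the input of length \<open>N\<close> there are four arrays of \<open>n\<close> cells: \<open>W\<close> (vertex at a position), \<open>P\<close>
  (position of a vertex), \<open>C\<close> (chord at a position) and \<open>S\<close> (sum of the positions of the two neighbours
  in the current 2-regular graph).  The sum makes an exchange a constant number of additions, and
  a cycle is traced without knowing its direction: the successor is \<open>S\<close> minus the predecessor.
\<close>

abbreviation (input) "rN \<equiv> 0 :: nat"
abbreviation (input) "rZero \<equiv> 2 :: nat"
abbreviation (input) "rW \<equiv> 3 :: nat"
abbreviation (input) "rP \<equiv> 4 :: nat"
abbreviation (input) "rC \<equiv> 5 :: nat"
abbreviation (input) "rS \<equiv> 6 :: nat"
abbreviation (input) "rZ \<equiv> 7 :: nat"
abbreviation (input) "rPb \<equiv> 8 :: nat"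
abbreviation (input) "rLast \<equiv> 9 :: nat"
abbreviation (input) "rOne \<equiv> 10 :: nat"
abbreviation (input) "rH \<equiv> 11 :: nat"
abbreviation (input) "rA \<equiv> 12 :: nat"
abbreviation (input) "rB \<equiv> 13 :: nat"
abbreviation (input) "rE \<equiv> 14 :: nat"
abbreviation (input) "rI \<equiv> 15 :: nat"
abbreviation (input) "rU \<equiv> 16 :: nat"
abbreviation (input) "rY \<equiv> 17 :: nat"
abbreviation (input) "rO \<equiv> 18 :: nat"
abbreviation (input) "rD \<equiv> 19 :: nat"
abbreviation (input) "rStart \<equiv> 20 :: nat"
abbreviation (input) "rAd \<equiv> 21 :: nat"
abbreviation (input) "rT \<equiv> 22 :: nat"

abbreviation const :: "nat \<Rightarrow> nat \<Rightarrow> com" where "const i k \<equiv> Ins (Const i k)"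
abbreviation add :: "nat \<Rightarrow> nat \<Rightarrow> nat \<Rightarrow> com" where "add i j k \<equiv> Ins (Add i j k)"
abbreviation sub :: "nat \<Rightarrow> nat \<Rightarrow> nat \<Rightarrow> com" where "sub i j k \<equiv> Ins (Sub i j k)"
abbreviation load :: "nat \<Rightarrow> nat \<Rightarrow> com" where "load i j \<equiv> Ins (Load i j)"
abbreviation store :: "nat \<Rightarrow> nat \<Rightarrow> com" where "store i j \<equiv> Ins (Store i j)"

text \<open>Absolute difference. With \<open><\<close> as the only test, inequality of
  \<open>x\<close> and \<open>y\<close> is tested as \<open>0 < gap x y\<close>.\<close>

definition gap :: "nat \<Rightarrow> nat \<Rightarrow> nat" where "gap x y = (x - y) + (y - x)"

definition set_gap :: "nat \<Rightarrow> nat \<Rightarrow> com" where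
  "set_gap i j = sub rD i j ;; sub rT j i ;; add rD rD rT"

text \<open>\<open>rN\<close> is register 0, where the machine model expects the output length.
  \<open>rE\<close> first holds the number of edges, added twice to obtain the input length, and
  then the address of the first edge. Reading cell 0 relies on registers being zero
  initially.\<close>

definition init :: com where
  "init =
     load rN rZero ;; const rOne 1 ;; load rE rOne ;;
     const rAd 2 ;; load rA rAd ;; const rAd 3 ;; load rB rAd ;; const rH 4 ;;
     add rW rH rN ;; add rW rW rE ;; add rW rW rE ;; add rE rH rN ;;
     add rP rW rN ;; add rC rP rN ;; add rS rC rN ;;
     const rU 0 ;; load rT rH ;; set_gap rT rA"

definition search_body :: com where
  "search_body = add rU rU rOne ;; add rAd rH rU ;; load rT rAd ;; set_gap rT rA"

text \<open>The entry \<open>i + i\<close> of \<open>S\<close> is the sum of \<open>i - 1\<close>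
  and \<open>i + 1\<close>. It is wrong at the two ends, where \<open>anchors\<close> corrects
  it.\<close>

definition rotate_body :: com where
  "rotate_body =
     add rAd rH rU ;; load rT rAd ;; add rAd rW rI ;; store rAd rT ;;
     add rAd rP rT ;; store rAd rI ;;
     add rT rI rI ;; add rAd rS rI ;; store rAd rT ;;
     add rU rU rOne ;; IfLess rU rN Skip (const rU 0) ;; add rI rI rOne"

definition anchors :: com where
  "anchors =
     store rS rN ;; sub rLast rN rOne ;; add rAd rS rLast ;; sub rT rLast rOne ;; store rAd rT ;;
     add rAd rP rB ;; load rPb rAd ;;
     IfLess rOne rPb (const rZ 1) (add rZ rLast rZero)"

text \<open>Each chord is written at both of its ends, overwriting earlier ones; any chord will
  do.\<close>

definition edge_body :: com where
  "edge_body =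
     load rU rE ;; add rAd rP rU ;; load rU rAd ;; add rE rE rOne ;;
     load rY rE ;; add rAd rP rY ;; load rY rAd ;; add rE rE rOne ;;
     set_gap rU rY ;;
     IfLess rOne rD
       (IfLess rD rLast
         (add rAd rC rU ;; store rAd rY ;; add rAd rC rY ;; store rAd rU)
         Skip)
       Skip"

definition get_shift :: com where
  "get_shift =
     add rAd rC rU ;; load rY rAd ;;
     IfLess rZero rY
       (IfLess rU rY (sub rO rY rOne) (add rO rY rOne))
       (add rO rZ rZero)"

definition walk_body :: com where
  "walk_body = get_shift ;; add rU rO rZero ;; add rI rI rOne"

definition exchange_body :: com where
  "exchange_body =
     get_shift ;;
     add rAd rC rO ;; load rD rAd ;; add rAd rS rO ;; load rT rAd ;;
     sub rT rT rY ;; add rT rT rD ;; store rAd rT ;;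
     add rAd rS rY ;; load rT rAd ;; sub rT rT rO ;; add rT rT rU ;; store rAd rT ;;
     add rU rO rZero ;; set_gap rU rStart"

text \<open>The output overwrites the input from cell 0 on. It has \<open>n\<close> cells and the
  arrays begin behind the input, so nothing still needed is lost.\<close>

definition trace_body :: com where
  "trace_body =
     add rAd rW rU ;; load rT rAd ;; store rI rT ;;
     add rAd rS rY ;; load rT rAd ;; sub rT rT rU ;;
     add rU rY rZero ;; add rY rT rZero ;; add rI rI rOne"

text \<open>After \<open>n\<close> shifts the walk is certain to be on one of the cycles of the shift.\<close>

definition exchange_phase :: com where
  "exchange_phase =
     (const rU 1 ;; const rI 0) ;; WhileLess rI rN walk_body ;;
     (add rStart rU rZero ;; const rD 1) ;; WhileLess rZero rD exchange_body ;;
     (const rU 0 ;; add rY rPb rZero ;; const rI 0) ;; WhileLess rI rN trace_body"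

definition algorithm :: com where
  "algorithm =
     init ;; WhileLess rZero rD search_body ;;
     const rI 0 ;; WhileLess rI rN rotate_body ;;
     anchors ;; WhileLess rE rW edge_body ;; exchange_phase"

lemma gap_pos [simp]: "0 < gap x y \<longleftrightarrow> x \<noteq> y"
  by (auto simp: gap_def)

lemma length_concat_pairs: "length (concat (map (\<lambda>(u, v). [u, v]) es)) = 2 * length es"
  by (induction es) auto

lemma nth_concat_pairs:
  "k < length es \<Longrightarrow> concat (map (\<lambda>(u, v). [u, v]) es) ! (2 * k) = fst (es ! k)"
  "k < length es \<Longrightarrow> concat (map (\<lambda>(u, v). [u, v]) es) ! Suc (2 * k) = snd (es ! k)"
proof (induction es arbitrary: k)
  case (Cons e es)
  { case 1 then show ?case using Cons.IH(1) by (cases k) (auto split: prod.split) }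
  { case 2 then show ?case using Cons.IH(2) by (cases k) (auto split: prod.split) }
qed auto

text \<open>\<open>hs\<close> is the cycle as given and \<open>ws\<close> its rotation by
  \<open>q\<close> that starts at \<open>a\<close>; positions refer to \<open>ws\<close>. The bound
  \<open>B\<close> is five times the input length: the input and four arrays of \<open>n\<close>
  cells fit below it.\<close>

locale ram_input = hamiltonian_pfaffian V E A ws for V :: "nat set" and E A ws +
  fixes es :: "(nat \<times> nat) list" and hs :: "nat list" and a b q pb z B :: nat
  assumes V: "V = {..<length ws}"
    and listing: "edge_listing E es"
    and min_degree: "\<And>v. v < length ws \<Longrightarrow> 3 \<le> degree E v"
    and q: "q < length ws" and len_hs: "length hs = length ws"
    and distinct_input: "distinct hs" and set_input: "set hs = {..<length ws}"
    and ws_nth: "\<And>i. i < length ws \<Longrightarrow> ws ! i = hs ! ((q + i) mod length ws)"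
    and a: "ws ! 0 = a" and b: "ws ! pb = b"
    and pb: "pb = 1 \<or> pb = length ws - 1"
    and z: "z = (if 1 < pb then 1 else length ws - 1)"
    and B: "B = 5 * (4 + length ws + 2 * length es)"
begin

definition N :: nat where "N = 4 + n + 2 * length es"

abbreviation word :: "nat list" where "word \<equiv> encode n es hs (a, b)"

abbreviation input_mem :: "nat \<Rightarrow> nat" where "input_mem \<equiv> mem (initial word)"

lemma length_word: "length word = N"
  by (simp add: encode_def length_concat_pairs N_def len_hs)

lemma input_mem:
  "input_mem 0 = n" "input_mem 1 = length es" "input_mem 2 = a" "input_mem 3 = b"
  "i < n \<Longrightarrow> input_mem (4 + i) = hs ! i"
  "k < length es \<Longrightarrow> input_mem (4 + n + 2 * k) = fst (es ! k)"
  "k < length es \<Longrightarrow> input_mem (5 + n + 2 * k) = snd (es ! k)"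
  using length_word nth_concat_pairs
  by (auto simp: initial_def N_def encode_def nth_append len_hs length_concat_pairs nth_Cons')


lemma ws_nonempty [simp]: "ws \<noteq> []"
  using n3 by auto

lemma B_ge: "N + 4 * n + 4 \<le> B" "2 * n \<le> B"
  using n3 unfolding B N_def by simp_all

lemma ws_less: "i < n \<Longrightarrow> ws ! i < n"
  using set_hs V nth_mem[of i ws] by auto

lemma hs_less: "i < n \<Longrightarrow> hs ! i < n"
  using set_input len_hs nth_mem[of i hs] by auto

lemma a_b_less: "a < n" "b < n" "pb < n"
  using ws_less a b pb n3 by auto

definition base :: "(nat \<Rightarrow> nat) \<Rightarrow> bool" where
  "base r \<longleftrightarrow> r rN = n \<and> r rZero = 0 \<and> r rW = N \<and> r rP = N + n \<and> r rC = N + 2 * n \<and>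
     r rS = N + 3 * n \<and> r rOne = 1 \<and> r rH = 4 \<and> r rB = b"

section \<open>Numbering the vertices and collecting the chords\<close>

lemma init_hoare:
  "hoare B (\<lambda>r m. r = (\<lambda>_. 0) \<and> m = input_mem) init (ctime init)
     (\<lambda>r m. base r \<and> r rA = a \<and> r rE = 4 + n \<and> r rU = 0 \<and> r rD = gap (hs ! 0) a \<and>
        m = input_mem)"
proof (rule hoare_vcg)
  fix r m :: "nat \<Rightarrow> nat"
  assume *: "r = (\<lambda>_. 0) \<and> m = input_mem"
  have i4: "input_mem 4 = hs ! 0" using input_mem(5)[of 0] n3 by simp
  have l: "hs ! 0 < n" using hs_less[of 0] n3 by simp
  have B': "N + 3 * n \<le> B" "4 \<le> B" "4 + n + length es \<le> N" "N = 4 + n + 2 * length es"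
    using B_ge by (auto simp: N_def)
  show "wp B init (\<lambda>r m. base r \<and> r rA = a \<and> r rE = 4 + n \<and> r rU = 0 \<and>
      r rD = gap (hs ! 0) a \<and> m = input_mem) r m"
    using * B' l a_b_less n3
    by (simp add: init_def set_gap_def input_mem(1-4) input_mem(2)[simplified] i4 base_def gap_def)
qed

definition search_inv :: "nat \<Rightarrow> (nat \<Rightarrow> nat) \<Rightarrow> (nat \<Rightarrow> nat) \<Rightarrow> bool" where
  "search_inv k r m \<longleftrightarrow> base r \<and> r rA = a \<and> r rE = 4 + n \<and> r rU = k \<and> r rD = gap (hs ! k) a \<and>
     m = input_mem"

lemma search_hoare:
  "hoare B (search_inv 0) (WhileLess rZero rD search_body) (q * (ctime search_body + 2) + 2)
     (search_inv q)"
proof (rule hoare_WhileLess)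
  have hs_q: "hs ! q = a" using ws_nth[of 0] a q by simp
  fix k assume k: "k < q"
  show "hoare B (search_inv k) search_body (ctime search_body) (search_inv (Suc k))"
  proof (rule hoare_vcg)
    fix r m
    assume "search_inv k r m"
    moreover have "input_mem (Suc (4 + k)) = hs ! Suc k" "hs ! Suc k < n"
      using input_mem(5)[of "Suc k"] hs_less k q by (auto simp: algebra_simps)
    ultimately show "wp B search_body (search_inv (Suc k)) r m"
      using k q B_ge a_b_less
      by (simp add: search_inv_def base_def search_body_def set_gap_def gap_def)
  qed
  fix r m assume "search_inv k r m"
  moreover have "hs ! k \<noteq> a"
    using hs_q distinct_input k q len_hs by (auto simp: nth_eq_iff_index_eq)
  ultimately show "r rZero < r rD" by (simp add: search_inv_def base_def)
next
  fix r m assume "search_inv q r m"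
  moreover have "hs ! q = a" using ws_nth[of 0] a q by simp
  ultimately show "\<not> r rZero < r rD" by (simp add: search_inv_def base_def)
qed

definition rotate_inv :: "nat \<Rightarrow> (nat \<Rightarrow> nat) \<Rightarrow> (nat \<Rightarrow> nat) \<Rightarrow> bool" where
  "rotate_inv k r m \<longleftrightarrow> base r \<and> r rE = 4 + n \<and> r rI = k \<and> r rU = (q + k) mod n \<and>
     (\<forall>i<k. m (N + i) = ws ! i \<and> m (N + n + ws ! i) = i \<and> m (N + 3 * n + i) = 2 * i) \<and>
     (\<forall>i<N. m i = input_mem i)"

lemma rotate_hoare:
  "hoare B (rotate_inv 0) (WhileLess rI rN rotate_body) (n * (ctime rotate_body + 2) + 2)
     (rotate_inv n)"
proof (rule hoare_WhileLess)
  fix k assume k: "k < n"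
  show "hoare B (rotate_inv k) rotate_body (ctime rotate_body) (rotate_inv (Suc k))"
  proof (rule hoare_vcg)
    fix r m
    assume inv: "rotate_inv k r m"
    let ?j = "(q + k) mod n"
    have j: "?j < n" using k by (intro mod_less_divisor) simp
    have m: "m (4 + ?j) = ws ! k"
    proof -
      have "4 + ?j < N" unfolding N_def using j by linarith
      then have "m (4 + ?j) = input_mem (4 + ?j)" using inv unfolding rotate_inv_def by blast
      then show ?thesis using input_mem(5)[OF j] ws_nth[OF k] by simp
    qed
    have neq: "ws ! i \<noteq> ws ! k" if "i < k" for i using hs_eq_iff[of i k] that k by simp
    have lt: "ws ! i < n" if "i < k" for i using ws_less that k by simp
    have n: "n \<le> N" by (simp add: N_def)
    \<comment> \<open>The machine has no remainder operation, so the index wraps by a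
      comparison.\<close>
    have j': "(q + Suc k) mod n = (if Suc ?j < n then Suc ?j else 0)"
    proof -
      have "(if Suc x = n then 0 else Suc x) = (if Suc x < n then Suc x else 0)" if "x < n" for x
        using that by auto
      from this[OF j] show ?thesis by (simp only: add_Suc_right mod_Suc)
    qed
    let ?m = "m(N + k := ws ! k, N + n + ws ! k := k, N + 3 * n + k := k + k)"
    have arr: "\<forall>i<Suc k. ?m (N + i) = ws ! i \<and> ?m (N + n + ws ! i) = i \<and>
        ?m (N + 3 * n + i) = 2 * i"
    proof (intro allI impI)
      fix i assume "i < Suc k"
      then consider "i < k" | "i = k" by linarith
      then show "?m (N + i) = ws ! i \<and> ?m (N + n + ws ! i) = i \<and> ?m (N + 3 * n + i) = 2 * i"
      proof cases
        case 1
        then show ?thesis using inv neq[OF 1] lt[OF 1] ws_less[OF k] k by (simp add: rotate_inv_def)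
      next
        case 2
        then show ?thesis using ws_less[OF k] k by simp
      qed
    qed
    have low: "\<forall>i<N. ?m i = input_mem i" using inv by (simp add: rotate_inv_def)
    have bj: "4 + ?j \<le> B" "Suc ?j \<le> B" using j n B_ge by linarith+
    show "wp B rotate_body (rotate_inv (Suc k)) r m"
      using inv bj m k ws_less[OF k] B_ge n arr low j'
      by (simp add: rotate_inv_def base_def rotate_body_def)
  qed
  fix r m assume "rotate_inv k r m"
  then show "r rI < r rN" using k by (simp add: rotate_inv_def base_def)
next
  fix r m assume "rotate_inv n r m"
  then show "\<not> r rI < r rN" by (simp add: rotate_inv_def base_def)
qed

definition base2 :: "(nat \<Rightarrow> nat) \<Rightarrow> bool" where
  "base2 r \<longleftrightarrow> base r \<and> r rLast = n - 1 \<and> r rPb = pb \<and> r rZ = z"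

definition arrays :: "(nat \<Rightarrow> nat) \<Rightarrow> (nat \<Rightarrow> nat) \<Rightarrow> bool" where
  "arrays s m \<longleftrightarrow> (\<forall>i<n. m (N + i) = ws ! i \<and> m (N + n + ws ! i) = i \<and> m (N + 3 * n + i) = s i)"

text \<open>Neighbour sums of the given cycle: \<open>1 + (n - 1)\<close> at position 0 and
  \<open>(n - 2) + 0\<close> at the last position.\<close>

definition sums :: "nat \<Rightarrow> nat" where
  "sums i = (if i = 0 then n else if i = n - 1 then n - 2 else 2 * i)"

definition good :: "nat \<Rightarrow> nat \<Rightarrow> bool" where
  "good x y \<longleftrightarrow> y < n \<and> adj x y \<and> 1 < gap x y \<and> gap x y < n - 1"

text \<open>Which chord is stored depends on the listing. The invariant only promises some chord at
  every position for which one has been read.\<close>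

definition edge_inv :: "nat \<Rightarrow> (nat \<Rightarrow> nat) \<Rightarrow> (nat \<Rightarrow> nat) \<Rightarrow> bool" where
  "edge_inv k r m \<longleftrightarrow> base2 r \<and> r rE = 4 + n + 2 * k \<and> arrays sums m \<and> (\<forall>i<N. m i = input_mem i) \<and>
     (\<forall>x<n. \<forall>l<k. \<forall>y. {fst (es ! l), snd (es ! l)} = {ws ! x, ws ! y} \<and> good x y \<longrightarrow>
        good x (m (N + 2 * n + x)))"

lemma anchors_hoare: "hoare B (rotate_inv n) anchors (ctime anchors) (edge_inv 0)"
proof (rule hoare_vcg)
  fix r m
  assume inv: "rotate_inv n r m"
  let ?m = "m(N + 3 * n := n, N + 3 * n + (n - 1) := n - 1 - 1)"
  have arr: "arrays sums ?m"
    unfolding arrays_def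
  proof (intro allI impI)
    fix i assume i: "i < n"
    have 1: "m (N + i) = ws ! i" "m (N + n + ws ! i) = i" "m (N + 3 * n + i) = 2 * i"
      using inv i by (simp_all add: rotate_inv_def)
    have 2: "ws ! i < n" using ws_less[OF i] .
    have "N + i \<noteq> N + 3 * n + (n - 1)" "N + n + ws ! i \<noteq> N + 3 * n + (n - 1)"
      "N + i \<noteq> N + 3 * n" "N + n + ws ! i \<noteq> N + 3 * n"
      using 2 i n3 by linarith+
    then have "?m (N + i) = ws ! i" "?m (N + n + ws ! i) = i"
      using 1 by simp_all
    moreover have "?m (N + 3 * n + i) = sums i"
    proof (cases "i = 0 \<or> i = n - 1")
      case True
      then show ?thesis using n3 by (auto simp: sums_def)
    next
      case False
      then have "N + 3 * n + i \<noteq> N + 3 * n + (n - 1)" "N + 3 * n + i \<noteq> N + 3 * n" by linarith+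
      then show ?thesis using 1 i False by (simp add: sums_def)
    qed
    ultimately show "?m (N + i) = ws ! i \<and> ?m (N + n + ws ! i) = i \<and> ?m (N + 3 * n + i) = sums i"
      by blast
  qed
  have low: "\<forall>i<N. ?m i = input_mem i" using inv by (simp add: rotate_inv_def)
  have p: "?m (N + n + b) = pb" using arr a_b_less b by (auto simp: arrays_def)
  have bn: "N + 3 * n + (n - 1) \<le> B" "n - 1 \<le> B" using B_ge n3 by linarith+
  have post: "edge_inv 0 r' ?m" if "base r'" "r' rLast = n - 1" "r' rPb = pb" "r' rZ = z" "r' rE = 4 + n"
    for r'
    unfolding edge_inv_def base2_def using that arr low by simp
  show "wp B anchors (edge_inv 0) r m"
    using bn inv p B_ge a_b_less n3 post z
    by (cases "1 < pb") (simp_all add: anchors_def rotate_inv_def base_def)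
qed

lemma edges_index:
  assumes "k < length es"
  obtains x y where "x < n" "y < n" "fst (es ! k) = ws ! x" "snd (es ! k) = ws ! y" "adj x y"
proof -
  have "{fst (es ! k), snd (es ! k)} \<in> E"
    using listing assms nth_mem[OF assms] by (force simp: edge_listing_def split: prod.splits)
  moreover from this have "fst (es ! k) \<in> set ws" "snd (es ! k) \<in> set ws"
    using simple set_hs by (auto simp: simple_graph_def doubleton_eq_iff)
  ultimately show ?thesis using that by (metis in_set_conv_nth)
qed

lemma gap_commute: "gap x y = gap y x"
  by (simp add: gap_def)

lemma good_commute: "x < n \<Longrightarrow> good x y \<Longrightarrow> good y x"
  by (simp add: good_def gap_commute insert_commute)

lemma edge_hoare:
  "hoare B (edge_inv 0) (WhileLess rE rW edge_body) (length es * (ctime edge_body + 2) + 2)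
     (edge_inv (length es))"
proof (rule hoare_WhileLess)
  fix k assume k: "k < length es"
  obtain x y where xy: "x < n" "y < n" "fst (es ! k) = ws ! x" "snd (es ! k) = ws ! y" "adj x y"
    using edges_index[OF k] .
  show "hoare B (edge_inv k) edge_body (ctime edge_body) (edge_inv (Suc k))"
  proof (rule hoare_vcg)
    fix r m
    assume inv: "edge_inv k r m"
    let ?m = "if 1 < gap x y \<and> gap x y < n - 1
      then m(N + 2 * n + x := y, N + 2 * n + y := x) else m"
    have e: "m (4 + n + 2 * k) = ws ! x" "m (Suc (4 + n + 2 * k)) = ws ! y"
    proof -
      have "\<forall>i<N. m i = input_mem i" using inv by (simp add: edge_inv_def)
      moreover have "4 + n + 2 * k < N" "5 + n + 2 * k < N" using k unfolding N_def by linarith+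
      ultimately have "m (4 + n + 2 * k) = ws ! x" "m (5 + n + 2 * k) = ws ! y"
        using input_mem(6,7)[OF k] xy by simp_all
      moreover have "5 + n + 2 * k = Suc (4 + n + 2 * k)" by simp
      ultimately show "m (4 + n + 2 * k) = ws ! x" "m (Suc (4 + n + 2 * k)) = ws ! y"
        by metis+
    qed
    have p: "m (N + n + ws ! x) = x" "m (N + n + ws ! y) = y"
      using inv xy by (simp_all add: edge_inv_def arrays_def)
    have ineq: "Suc (4 + n + 2 * k) \<le> B" "N + n + ws ! x \<le> B" "N + n + ws ! y \<le> B"
      "x - y + (y - x) \<le> B" "Suc (Suc (4 + n + 2 * k)) \<le> B"
      using B_ge xy(1,2) ws_less[OF xy(1)] ws_less[OF xy(2)] k by (simp_all add: N_def)
    have arr: "arrays sums ?m"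
      unfolding arrays_def
    proof (intro allI impI)
      fix i assume i: "i < n"
      have "ws ! i < n" using ws_less[OF i] .
      then show "?m (N + i) = ws ! i \<and> ?m (N + n + ws ! i) = i \<and> ?m (N + 3 * n + i) = sums i"
        using inv i xy(1,2) by (simp add: edge_inv_def arrays_def)
    qed
    have low: "\<forall>i<N. ?m i = input_mem i" using inv by (simp add: edge_inv_def)
    have chords: "good u (?m (N + 2 * n + u))"
      if u: "u < n" "l < Suc k" "{fst (es ! l), snd (es ! l)} = {ws ! u, ws ! v}" "good u v"
      for u l v
    proof (cases "good x y \<and> (u = x \<or> u = y)")
      case True
      then show ?thesis using good_commute[OF xy(1)] xy by (auto simp: good_def)
    next
      case False
      have "l \<noteq> k"
      proof
        assume "l = k"
        then have "{ws ! x, ws ! y} = {ws ! u, ws ! v}" using u xy by simp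
        then have "u = x \<and> v = y \<or> u = y \<and> v = x"
          using u xy(1,2) hs_eq_iff by (auto simp: doubleton_eq_iff good_def)
        then show False using False u(1,4) good_commute by blast
      qed
      then have "good u (m (N + 2 * n + u))"
        using inv u less_antisym unfolding edge_inv_def by blast
      moreover have "?m (N + 2 * n + u) = m (N + 2 * n + u)"
        using False xy by (auto simp: good_def)
      ultimately show ?thesis by simp
    qed
    let ?R = "edge_inv (Suc k)"
    have post: "edge_inv (Suc k) r' ?m" if "base2 r'" "r' rE = 4 + n + 2 * Suc k" for r'
      unfolding edge_inv_def using that arr low chords by blast
    have b2: "base2 r" and rE: "r rE = 4 + n + 2 * k" using inv by (simp_all add: edge_inv_def)
    show "wp B edge_body ?R r m"
    proof (cases "1 < gap x y \<and> gap x y < n - 1")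
      case True
      then show ?thesis
        using e p ineq B_ge xy(1,2) b2 rE True post
        by (simp add: edge_body_def set_gap_def base_def base2_def gap_def)
    next
      case False
      then show ?thesis
        using e p ineq B_ge xy(1,2) b2 rE False post[unfolded if_not_P[OF False]]
        by (simp add: edge_body_def set_gap_def base_def base2_def gap_def)
    qed
  qed
  fix r m assume "edge_inv k r m"
  then show "r rE < r rW" using k by (simp add: edge_inv_def base2_def base_def N_def)
next
  fix r m assume "edge_inv (length es) r m"
  then show "\<not> r rE < r rW" by (simp add: edge_inv_def base2_def base_def N_def)
qed

text \<open>Of at least three edges at a vertex, at most two lead to the positions in
  \<open>near\<close>.\<close>

lemma chord_exists:
  assumes x: "x < n"
  shows "\<exists>y l. l < length es \<and> {fst (es ! l), snd (es ! l)} = {ws ! x, ws ! y} \<and> good x y"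
proof -
  define near where "near = {(if x = 0 then n - 1 else x - 1), (if Suc x = n then 0 else Suc x)}"
  have inc: "\<exists>y<n. e = {ws ! x, ws ! y}" if e: "e \<in> E" "ws ! x \<in> e" for e
  proof -
    obtain u v where "u \<in> V" "v \<in> V" "e = {u, v}"
      using simple e(1) unfolding simple_graph_def by blast
    then obtain w where "w \<in> set ws" "e = {ws ! x, w}" using e(2) set_hs by auto
    then show ?thesis by (metis in_set_conv_nth)
  qed
  have "\<exists>y<n. adj x y \<and> y \<notin> near"
  proof (rule ccontr)
    assume "\<not> ?thesis"
    then have "{e \<in> E. ws ! x \<in> e} \<subseteq> (\<lambda>y. {ws ! x, ws ! y}) ` near"
      using inc by blast
    then have "card {e \<in> E. ws ! x \<in> e} \<le> card near"
      by (rule surj_card_le[rotated]) (simp add: near_def)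
    also have "card near \<le> 2" by (simp add: near_def card_insert_if)
    finally show False using min_degree[OF ws_less[OF x]] by (simp add: degree_def)
  qed
  then obtain y where y: "y < n" "adj x y" "y \<notin> near" by blast
  have "x \<noteq> y" using y(2) not_adj_refl by blast
  then have "1 < gap x y" "gap x y < n - 1"
    using y(1,3) x unfolding near_def gap_def by (auto split: if_splits)
  then have "good x y" using y by (simp add: good_def)
  moreover have "{ws ! x, ws ! y} \<in> set (map (\<lambda>(u, v). {u, v}) es)"
    using listing y(2) by (simp add: edge_listing_def)
  then obtain l where "l < length es" "{fst (es ! l), snd (es ! l)} = {ws ! x, ws ! y}"
    by (auto simp: in_set_conv_nth split: prod.splits)
  ultimately show ?thesis by blast
qed

definition result :: "(nat \<Rightarrow> nat) \<Rightarrow> (nat \<Rightarrow> nat) \<Rightarrow> bool" where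
  "result r m \<longleftrightarrow> (\<exists>ys. r rN = n \<and> length ys = n \<and> (\<forall>i<n. m i = ys ! i) \<and>
     hamiltonian_cycle V E ys \<and> cycle_edges ys \<noteq> cycle_edges ws \<and> {a, b} \<in> cycle_edges ys)"

end

text \<open>The chord function is known only from the memory after the edge phase, so the lemmas
  about it live in a locale of their own.\<close>

locale ram_chord =
  ram_input V E A ws es hs a b q pb z B + chord_choice V E A ws Ch pb z
  for V :: "nat set" and E A ws es hs a b q pb z B Ch
begin

definition chords :: "(nat \<Rightarrow> nat) \<Rightarrow> bool" where
  "chords m \<longleftrightarrow> (\<forall>i<n. m (N + 2 * n + i) = Ch i)"

lemma nbsum_empty_eq: "i < n \<Longrightarrow> nbsum {} i = sums i"
  using n4 by (auto simp: nbsum_empty lft_def rgt_def sums_def)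

lemma arrays_cong: "(\<And>i. i < n \<Longrightarrow> s i = s' i) \<Longrightarrow> arrays s m = arrays s' m"
  by (auto simp: arrays_def)

lemma repl_less:
  assumes "D \<subseteq> C" "v < n" "w < n"
  shows "repl D v w < n"
  using assms C_props[of "prev w"] prev(1)[of w] chord[of v] by (auto simp: repl_def)

text \<open>Needed for all intermediate \<open>t\<close>, because the word size must be respected
  during the exchanges as well.\<close>

lemma nbsum_le: "t \<le> period \<Longrightarrow> v < n \<Longrightarrow> nbsum (cyc t) v \<le> 2 * n"
proof -
  assume t: "t \<le> period" and v: "v < n"
  have "repl (cyc t) v (lft v) < n" "repl (cyc t) v (rgt v) < n"
    using repl_less[OF cyc_subset[OF t] v] lft_rgt(1,2)[OF v] by blast+
  then show ?thesis by (simp add: nbsum_def)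
qed

text \<open>Bounds the number of exchanges, whose loop has no counter: the iterates 1, ...,
  \<open>period\<close> are distinct positions.\<close>

lemma period_le: "period \<le> n"
proof -
  have "inj_on (\<lambda>i. (shift ^^ Suc i) start) {..<period}"
  proof (rule linorder_inj_onI)
    fix i j :: nat assume "i < j" "j \<in> {..<period}"
    then show "(shift ^^ Suc i) start \<noteq> (shift ^^ Suc j) start"
      using pow_inj[of "Suc i" "Suc j"] by simp
  qed auto
  then have "card C = period" unfolding cyc_def by (simp only: card_image card_lessThan)
  moreover have "C \<subseteq> {..<n}" using C_props by blast
  ultimately show ?thesis using card_mono[of "{..<n}" C] by simp
qed

lemma wp_get_shift:
  assumes r: "base2 r" "r rU = u" and m: "chords m" and u: "u < n" "odd u"
    and R: "R (r(rAd := N + 2 * n + u, rY := Ch u, rO := shift u)) m"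
  shows "wp B get_shift R r m"
proof -
  have "m (N + 2 * n + u) = Ch u" "Ch u < n" using m u chord by (auto simp: chords_def)
  moreover have "z \<le> B" "Ch u < n \<Longrightarrow> Suc (Ch u) \<le> B" "N + 2 * n + u \<le> B"
    using B_ge ends u(1) by auto
  ultimately show ?thesis
    using r R
    by (cases "0 < Ch u"; cases "u < Ch u")
      (simp_all add: get_shift_def base2_def base_def shift_def)
qed

definition walk_inv :: "nat \<Rightarrow> (nat \<Rightarrow> nat) \<Rightarrow> (nat \<Rightarrow> nat) \<Rightarrow> bool" where
  "walk_inv k r m \<longleftrightarrow>
     base2 r \<and> r rU = (shift ^^ k) 1 \<and> r rI = k \<and> arrays sums m \<and> chords m"

lemma walk_hoare:
  "hoare B (walk_inv 0) (WhileLess rI rN walk_body) (n * (ctime walk_body + 2) + 2) (walk_inv n)"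
proof (rule hoare_WhileLess)
  fix k assume k: "k < n"
  show "hoare B (walk_inv k) walk_body (ctime walk_body) (walk_inv (Suc k))"
  proof (rule hoare_vcg)
    fix r m
    assume inv: "walk_inv k r m"
    let ?u = "(shift ^^ k) 1"
    have u: "?u < n" "odd ?u" using shift_pow by auto
    have s: "shift ?u \<le> B" using shift_props(1)[OF u] B_ge by linarith
    show "wp B walk_body (walk_inv (Suc k)) r m"
      unfolding walk_body_def wp.simps(7)
    proof (rule wp_get_shift[OF _ _ _ u])
      show "wp B (add rU rO rZero) (wp B (add rI rI rOne) (walk_inv (Suc k)))
          (r(rAd := N + 2 * n + ?u, rY := Ch ?u, rO := shift ?u)) m"
        using inv s k B_ge by (simp add: walk_inv_def base2_def base_def)
    qed (use inv in \<open>simp_all add: walk_inv_def\<close>)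
  qed
  fix r m assume "walk_inv k r m"
  then show "r rI < r rN" using k by (simp add: walk_inv_def base2_def base_def)
next
  fix r m assume "walk_inv n r m"
  then show "\<not> r rI < r rN" by (simp add: walk_inv_def base2_def base_def)
qed

text \<open>At \<open>k = 0\<close> the walk is at \<open>start\<close> already, so
  \<open>rD\<close> is preset to 1 to force the first round. Afterwards it is the distance to
  \<open>start\<close>, which vanishes only after a full period.\<close>

definition exchange_inv :: "nat \<Rightarrow> (nat \<Rightarrow> nat) \<Rightarrow> (nat \<Rightarrow> nat) \<Rightarrow> bool" where
  "exchange_inv k r m \<longleftrightarrow>
     base2 r \<and> r rU = (shift ^^ k) start \<and> r rStart = start \<and> (0 < r rD \<longleftrightarrow> k < period) \<and>
     arrays (nbsum (cyc k)) m \<and> chords m"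

lemma exchange_hoare:
  "hoare B (exchange_inv 0) (WhileLess rZero rD exchange_body)
     (period * (ctime exchange_body + 2) + 2) (exchange_inv period)"
proof (rule hoare_WhileLess)
  fix k assume k: "k < period"
  show "hoare B (exchange_inv k) exchange_body (ctime exchange_body) (exchange_inv (Suc k))"
  proof (rule hoare_vcg)
    fix r m
    assume inv: "exchange_inv k r m"
    define u where "u = (shift ^^ k) start"
    define w where "w = shift u"
    define y where "y = Ch u"
    define S where "S = nbsum (cyc k)"
    define S' where "S' = nbsum (cyc (Suc k))"
    have uC: "u \<in> C" using pow_in_C[OF k] by (simp add: u_def)
    note u = C_props[OF uC]
    have un: "u < n" "odd u" using u by auto
    have w: "w < n" "odd w" using shift_props(1,2)[OF un] by (simp_all add: w_def)
    have y: "y < n" "even y" using chord[OF un(1)] odd_chord[OF un(1)] un(2) by (auto simp: y_def)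
    have yw: "y \<noteq> w" using w y by auto
    have fresh: "shift u \<notin> cyc k" using cyc_fresh[OF k] by (simp add: u_def)
    have cs: "cyc (Suc k) = insert (shift u) (cyc k)" by (simp add: cyc_Suc u_def)
    note ins = nbsum_insert[OF uC fresh, folded cs S_def S'_def w_def y_def]
    have S': "S' w = S w - y + Ch w" "S' y = S y - w + u"
      "\<And>v. v < n \<Longrightarrow> v \<noteq> w \<Longrightarrow> v \<noteq> y \<Longrightarrow> S' v = S v"
      using ins(1) w y yw by auto
    have le: "S' v \<le> B" if "v < n" for v
      using nbsum_le[of "Suc k" v] k that B_ge by (simp add: S'_def)
    have mem: "m (N + 2 * n + w) = Ch w" "m (N + 3 * n + w) = S w" "m (N + 3 * n + y) = S y"
      using inv w y by (simp_all add: exchange_inv_def chords_def arrays_def S_def)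
    let ?m = "m(N + 3 * n + w := S' w, N + 3 * n + y := S' y)"
    have arr: "arrays S' ?m"
      unfolding arrays_def
    proof (intro allI impI)
      fix i assume i: "i < n"
      have m: "m (N + i) = ws ! i" "m (N + n + ws ! i) = i" "m (N + 3 * n + i) = S i"
        using inv i by (simp_all add: exchange_inv_def arrays_def S_def)
      have "ws ! i < n" using ws_less[OF i] .
      then have "?m (N + i) = ws ! i" "?m (N + n + ws ! i) = i"
        using m(1,2) i w y by simp_all
      moreover have "?m (N + 3 * n + i) = S' i"
        using m(3) S'(3)[OF i] by auto
      ultimately show "?m (N + i) = ws ! i \<and> ?m (N + n + ws ! i) = i \<and> ?m (N + 3 * n + i) = S' i"
        by blast
    qed
    have ch: "chords ?m" using inv w y by (simp add: exchange_inv_def chords_def)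
    have bounds: "N + 2 * n + w \<le> B" "N + 3 * n + w \<le> B" "N + 3 * n + y \<le> B" "w \<le> B"
      "w - start + (start - w) \<le> B"
      using w y B_ge C_props[OF start_in_C] by linarith+
    have flag: "0 < gap w start \<longleftrightarrow> Suc k < period"
    proof (cases "Suc k = period")
      case True
      then have "(shift ^^ Suc k) start = start" using period(2) by simp
      then have "w = start" by (simp add: w_def u_def)
      then show ?thesis using True by simp
    next
      case False
      then have "(shift ^^ Suc k) start \<noteq> start" using period(3)[of "Suc k"] k by simp
      then show ?thesis using False k by (simp add: w_def u_def)
    qed
    have wk: "(shift ^^ Suc k) start = w" by (simp add: w_def u_def)
    have post: "exchange_inv (Suc k) r' ?m"
      if "base2 r'" "r' rU = w" "r' rStart = start" "r' rD = gap w start" for r'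
      unfolding exchange_inv_def wk using that arr ch flag by (simp add: S'_def)
    have b2: "base2 r" and rU: "r rU = u" and rSt: "r rStart = start"
      using inv by (simp_all add: exchange_inv_def u_def)
    show "wp B exchange_body (exchange_inv (Suc k)) r m"
      unfolding exchange_body_def wp.simps(7)[of _ get_shift]
    proof (rule wp_get_shift[OF b2 rU _ un])
      show "chords m" using inv by (simp add: exchange_inv_def)
      have "S w - y + Ch w \<le> B" "S y - w + u \<le> B" using S' le w y by metis+
      then show "wp B
        (add rAd rC rO ;; load rD rAd ;; add rAd rS rO ;; load rT rAd ;;
         sub rT rT rY ;; add rT rT rD ;; store rAd rT ;;
         add rAd rS rY ;; load rT rAd ;; sub rT rT rO ;; add rT rT rU ;; store rAd rT ;;
         add rU rO rZero ;; set_gap rU rStart) (exchange_inv (Suc k))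
          (r(rAd := N + 2 * n + u, rY := Ch u, rO := shift u)) m"
        unfolding w_def[symmetric] y_def[symmetric]
        using b2 rU rSt mem bounds yw post S'(1,2)
        by (simp add: base2_def base_def set_gap_def gap_def)
    qed
  qed
  fix r m assume "exchange_inv k r m"
  then show "r rZero < r rD" using k by (simp add: exchange_inv_def base2_def base_def)
next
  fix r m assume "exchange_inv period r m"
  then show "\<not> r rZero < r rD" by (simp add: exchange_inv_def base2_def base_def)
qed

text \<open>The registers hold two consecutive positions, with indices modulo \<open>n\<close> so
  that the invariant also makes sense after the last round.\<close>

definition trace_inv :: "nat list \<Rightarrow> nat \<Rightarrow> (nat \<Rightarrow> nat) \<Rightarrow> (nat \<Rightarrow> nat) \<Rightarrow> bool" where
  "trace_inv vs k r m \<longleftrightarrow>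
     base2 r \<and> r rI = k \<and> r rU = vs ! (k mod n) \<and> r rY = vs ! (Suc k mod n) \<and>
     (\<forall>i<n. m (N + i) = ws ! i \<and> m (N + 3 * n + i) = nbsum C i) \<and> (\<forall>i<k. m i = ws ! (vs ! i))"

lemma trace_hoare:
  assumes vs: "\<And>i. i < n \<Longrightarrow> vs ! i < n"
    and sum: "\<And>i. i < n \<Longrightarrow>
      nbsum C (vs ! (Suc i mod n)) = vs ! i + vs ! (Suc (Suc i) mod n)"
  shows "hoare B (trace_inv vs 0) (WhileLess rI rN trace_body) (n * (ctime trace_body + 2) + 2)
     (trace_inv vs n)"
proof (rule hoare_WhileLess)
  fix k assume k: "k < n"
  show "hoare B (trace_inv vs k) trace_body (ctime trace_body) (trace_inv vs (Suc k))"
  proof (rule hoare_vcg)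
    fix r m
    assume inv: "trace_inv vs k r m"
    define u where "u = vs ! k"
    define y where "y = vs ! (Suc k mod n)"
    define x where "x = vs ! (Suc (Suc k) mod n)"
    have lt: "u < n" "y < n" "x < n" using vs k by (simp_all add: u_def y_def x_def)
    have S: "nbsum C y = u + x" using sum[OF k] by (simp add: u_def y_def x_def)
    have mem: "m (N + u) = ws ! u" "m (N + 3 * n + y) = u + x"
      using inv lt S by (simp_all add: trace_inv_def)
    have n: "n \<le> N" by (simp add: N_def)
    let ?m = "m(k := ws ! u)"
    have arr: "\<forall>i<n. ?m (N + i) = ws ! i \<and> ?m (N + 3 * n + i) = nbsum C i"
      using inv k n by (simp add: trace_inv_def)
    have out: "\<forall>i<Suc k. ?m i = ws ! (vs ! i)"
      using inv by (simp add: trace_inv_def u_def less_Suc_eq)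
    have bounds: "N + u \<le> B" "N + 3 * n + y \<le> B" "y \<le> B" "x \<le> B" "Suc k \<le> B"
      using lt k B_ge by linarith+
    have reg: "base2 r" "r rI = k" "r rU = u" "r rY = y"
      using inv k by (simp_all add: trace_inv_def u_def y_def)
    have post: "trace_inv vs (Suc k) r' ?m" if "base2 r'" "r' rI = Suc k" "r' rU = y" "r' rY = x" for r'
      unfolding trace_inv_def using that arr out by (simp add: y_def x_def)
    have far: "N + 3 * n + y \<noteq> k" using k n by linarith
    show "wp B trace_body (trace_inv vs (Suc k)) r m"
      using reg mem bounds post far by (simp add: trace_body_def base2_def base_def)
  qed
  fix r m assume "trace_inv vs k r m"
  then show "r rI < r rN" using k by (simp add: trace_inv_def base2_def base_def)
next
  fix r m assume "trace_inv vs n r m"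
  then show "\<not> r rI < r rN" by (simp add: trace_inv_def base2_def base_def)
qed

lemma exchange_phase_hoare:
  "hoare B (\<lambda>r m. base2 r \<and> arrays sums m \<and> chords m) exchange_phase (60 * n + 20) result"
proof -
  obtain vs where vs: "length vs = n" "distinct vs" "set vs = {..<n}" "vs ! 0 = 0" "vs ! 1 = pb"
    and sum: "\<And>i. i < n \<Longrightarrow> nbsum C (vs ! (Suc i mod n)) = vs ! i + vs ! (Suc (Suc i) mod n)"
    and ham': "hamiltonian_cycle V E (map ((!) ws) vs)"
      "cycle_edges (map ((!) ws) vs) \<noteq> cycle_edges ws"
      "{ws ! 0, ws ! pb} \<in> cycle_edges (map ((!) ws) vs)"
    using new_cycle by blast
  have lt: "vs ! i < n" if "i < n" for i
    using vs(1,3) that nth_mem[of i vs] by auto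
  have sB: "start \<le> B" "pb \<le> B" "1 \<le> B" using C_props[OF start_in_C] a_b_less B_ge by linarith+
  have 1: "hoare B (\<lambda>r m. base2 r \<and> arrays sums m \<and> chords m) (const rU 1 ;; const rI 0)
      (ctime (const rU 1 ;; const rI 0)) (walk_inv 0)"
    by (rule hoare_vcg) (use sB in \<open>simp add: walk_inv_def base2_def base_def\<close>)
  have 2: "hoare B (walk_inv n) (add rStart rU rZero ;; const rD 1)
      (ctime (add rStart rU rZero ;; const rD 1)) (exchange_inv 0)"
  proof (rule hoare_vcg)
    fix r m assume "walk_inv n r m"
    moreover have "arrays (nbsum (cyc 0)) m = arrays sums m"
      by (rule arrays_cong) (simp add: nbsum_empty_eq)
    ultimately show "wp B (add rStart rU rZero ;; const rD 1) (exchange_inv 0) r m"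
      using sB period(1)
      by (simp add: walk_inv_def exchange_inv_def base2_def base_def flip: One_nat_def start_def)
  qed
  have 3: "hoare B (exchange_inv period) (const rU 0 ;; add rY rPb rZero ;; const rI 0)
      (ctime (const rU 0 ;; add rY rPb rZero ;; const rI 0)) (trace_inv vs 0)"
    by (rule hoare_vcg)
      (use sB vs(4,5) n4 in \<open>simp add: trace_inv_def exchange_inv_def arrays_def base2_def base_def\<close>)
  have "period * (ctime exchange_body + 2) \<le> n * (ctime exchange_body + 2)"
    using period_le by (rule mult_le_mono1)
  \<comment> \<open>The loop bodies take 9, at most 23, and 9 steps, with 2 more per round, so the
    factor 60 is generous.\<close>
  then have time: "ctime (const rU 1 ;; const rI 0) + (n * (ctime walk_body + 2) + 2 +
      (ctime (add rStart rU rZero ;; const rD 1) + (period * (ctime exchange_body + 2) + 2 +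
      (ctime (const rU 0 ;; add rY rPb rZero ;; const rI 0) + (n * (ctime trace_body + 2) + 2)))))
      \<le> 60 * n + 20"
    by (simp add: walk_body_def exchange_body_def trace_body_def get_shift_def set_gap_def)
  show ?thesis
    unfolding exchange_phase_def
  proof (rule hoare_conseq[OF hoare_Seq[OF 1 hoare_Seq[OF walk_hoare hoare_Seq[OF 2
          hoare_Seq[OF exchange_hoare hoare_Seq[OF 3 trace_hoare[OF lt sum]]]]]] _ _ time])
    fix r m assume "trace_inv vs n r m"
    then have "r rN = n" "\<forall>i<n. m i = map ((!) ws) vs ! i"
      using vs(1) by (simp_all add: trace_inv_def base2_def base_def)
    then show "result r m"
      unfolding result_def using ham' vs(1) a b
      by (intro exI[of _ "map ((!) ws) vs"]) simp
  qed auto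
qed

end

text \<open>Allows the intermediate precondition to depend on the actual state, so that the chord
  function can be read off the memory and the locale interpreted with it.\<close>

lemma hoare_pre:
  assumes "\<And>r m. Q r m \<Longrightarrow> \<exists>Q'. Q' r m \<and> hoare B Q' c \<tau> R"
  shows "hoare B Q c \<tau> R"
proof (rule hoareI)
  fix P p r m
  assume *: "placed (compile c p) p P" "bounded B r m" "Q r m"
  obtain Q' where Q': "Q' r m" "hoare B Q' c \<tau> R" using assms[OF *(3)] by blast
  show "\<exists>t\<le>\<tau>. \<exists>r' m'. steps B P t (conf p r m) (conf (p + csize c) r' m') \<and> R r' m'"
    using Q'(2)[unfolded hoare_def, rule_format, OF *(1,2) Q'(1)] .
qed

context ram_input
begin

lemma exchange_phase_correct:
  "hoare B (edge_inv (length es)) exchange_phase (60 * n + 20) result"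
proof (rule hoare_pre)
  fix r m
  assume inv: "edge_inv (length es) r m"
  define Ch where "Ch i = m (N + 2 * n + i)" for i
  have Ch: "good i (Ch i)" if "i < n" for i
    using chord_exists[OF that] inv that unfolding edge_inv_def Ch_def by blast
  interpret ram_chord V E A ws es hs a b q pb z B Ch
  proof unfold_locales
    show "Ch i < n \<and> adj i (Ch i) \<and> 1 < (i - Ch i) + (Ch i - i) \<and> (i - Ch i) + (Ch i - i) < n - 1"
      if "i < n" for i using Ch[OF that] by (simp add: good_def gap_def)
    show "pb = 1 \<and> z = n - 1 \<or> pb = n - 1 \<and> z = 1"
      using pb z n3 by auto
  qed
  have "base2 r \<and> arrays sums m \<and> chords m"
    using inv by (simp add: edge_inv_def chords_def Ch_def)
  then show "\<exists>Q'. Q' r m \<and> hoare B Q' exchange_phase (60 * n + 20) result"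
    using exchange_phase_hoare
    by (intro exI[of _ "\<lambda>r m. base2 r \<and> arrays sums m \<and> chords m"]) blast
qed

lemma algorithm_correct:
  "hoare B (\<lambda>r m. r = (\<lambda>_. 0) \<and> m = input_mem) algorithm (200 * N) result"
proof -
  have 1: "hoare B (search_inv q) (const rI 0) (ctime (const rI 0)) (rotate_inv 0)"
  proof (rule hoare_vcg)
    fix r m assume "search_inv q r m"
    then show "wp B (const rI 0) (rotate_inv 0) r m"
      using q by (simp add: search_inv_def rotate_inv_def base_def)
  qed
  have 0: "hoare B (\<lambda>r m. r = (\<lambda>_. 0) \<and> m = input_mem) init (ctime init) (search_inv 0)"
    by (rule hoare_conseq[OF init_hoare]) (auto simp: search_inv_def)
  have "q * (ctime search_body + 2) \<le> n * (ctime search_body + 2)"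
    using q by (intro mult_le_mono1) simp
  moreover have "n + 2 * length es + 4 = N" by (simp add: N_def)
  ultimately have time: "ctime init + (q * (ctime search_body + 2) + 2 + (ctime (const rI 0) +
      (n * (ctime rotate_body + 2) + 2 + (ctime anchors +
      (length es * (ctime edge_body + 2) + 2 + (60 * n + 20)))))) \<le> 200 * N"
    by (simp add: init_def search_body_def rotate_body_def anchors_def edge_body_def set_gap_def)
  show ?thesis
    unfolding algorithm_def
    by (rule hoare_conseq[OF hoare_Seq[OF 0 hoare_Seq[OF search_hoare hoare_Seq[OF 1
          hoare_Seq[OF rotate_hoare hoare_Seq[OF anchors_hoare
          hoare_Seq[OF edge_hoare exchange_phase_correct]]]]]] _ _ time]) auto
qed

lemma input_bounded: "bounded B (\<lambda>_. 0) input_mem"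
proof -
  have "es ! k \<in> {..<n} \<times> {..<n}" if k: "k < length es" for k
    using edges_index[OF k] ws_less by (metis lessThan_iff mem_Times_iff)
  then have "set es \<subseteq> {..<n} \<times> {..<n}"
    by (metis in_set_conv_nth subsetI)
  then have "\<forall>x\<in>set word. x \<le> N"
    using set_input a_b_less by (fastforce simp: encode_def N_def len_hs)
  then have "input_mem i \<le> N" for i
    by (simp add: initial_def)
  then show ?thesis using B_ge by (simp add: bounded_def) (meson le_trans add_leD1)
qed

lemma computes_algorithm:
  "\<exists>ys. computes_in_linear_time 200 (compile algorithm 0) word ys \<and>
    hamiltonian_cycle V E ys \<and> cycle_edges ys \<noteq> cycle_edges ws \<and> {a, b} \<in> cycle_edges ys"
proof -
  let ?P = "compile algorithm 0"
  have "placed ?P 0 ?P" by (auto simp: placed_def)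
  from algorithm_correct[unfolded hoare_def, rule_format, OF this input_bounded]
  obtain t r m where t: "t \<le> 200 * N" "steps B ?P t (conf 0 (\<lambda>_. 0) input_mem) (conf (csize algorithm) r m)"
    "result r m" by auto
  have init: "conf 0 (\<lambda>_. 0) input_mem = initial word" by (simp add: initial_def)
  obtain ys where ys: "r rN = n" "length ys = n" "\<forall>i<n. m i = ys ! i"
    "hamiltonian_cycle V E ys" "cycle_edges ys \<noteq> cycle_edges ws" "{a, b} \<in> cycle_edges ys"
    using t(3) unfolding result_def by blast
  have out: "ram_output (conf (csize algorithm) r m) = ys"
    unfolding ram_output_def using ys(1-3) by (auto intro: nth_equalityI)
  \<comment> \<open>The constant 200 is both the time factor and the exponent of the word bound.
    From \<open>5 \<le> N\<close>, the bound \<open>5 * N\<close> is at most the square of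
    \<open>N\<close>.\<close>
  have N5: "5 \<le> N" unfolding N_def using n3 by linarith
  have "B = 5 * N" by (simp add: B N_def)
  also have "\<dots> \<le> N ^ 2" using N5 by (simp add: power2_eq_square)
  also have "\<dots> \<le> N ^ 200" using N5 by (intro power_increasing) auto
  finally have "B \<le> N ^ 200" .
  then have "computes_in_linear_time 200 ?P word ys"
    unfolding computes_in_linear_time_def length_word
    using t(1,2) out unfolding init steps_def bounded_def halted_def
    by (intro exI[of _ t]) (auto intro: le_trans)
  then show ?thesis using ys by blast
qed

end

lemma cycle_edges_rotate_subset: "cycle_edges (rotate q hs) \<subseteq> cycle_edges hs"
proof
  fix e assume "e \<in> cycle_edges (rotate q hs)"
  then obtain k where k: "k < length hs"
      "e = {rotate q hs ! k, rotate q hs ! (Suc k mod length hs)}"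
    by (auto simp: cycle_edges_eq)
  let ?j = "(q + k) mod length hs"
  have l: "Suc k mod length hs < length hs" "?j < length hs" using k(1) by (auto intro!: mod_less_divisor)
  have "rotate q hs ! k = hs ! ?j" using k(1) by (simp add: nth_rotate)
  moreover have "rotate q hs ! (Suc k mod length hs) = hs ! (Suc ?j mod length hs)"
    using l by (simp add: nth_rotate mod_simps)
  ultimately show "e \<in> cycle_edges hs" using k l by (auto simp: cycle_edges_eq)
qed

lemma cycle_edges_rotate: "cycle_edges (rotate q hs) = cycle_edges hs"
proof
  \<comment> \<open>Rotating back: together with the first \<open>q\<close> places this is a
    multiple of the length.\<close>
  have "rotate (length hs * q - q) (rotate q hs) = hs"
  proof (cases "hs = []")
    case False
    then have "length hs * q - q + q = length hs * q" by (cases "length hs") auto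
    then show ?thesis by (simp add: rotate_rotate rotate_id)
  qed simp
  then show "cycle_edges hs \<subseteq> cycle_edges (rotate q hs)"
    by (metis cycle_edges_rotate_subset)
qed (rule cycle_edges_rotate_subset)

theorem theorem1p1:
  shows "\<exists>(P :: program) (c :: nat).
    \<forall>(n :: nat) (E :: nat set set) (es :: (nat \<times> nat) list) (hs :: nat list) (a :: nat) (b :: nat).
      simple_graph {..<n} E \<longrightarrow>
      edge_listing E es \<longrightarrow>
      bipartite {..<n} E \<longrightarrow>
      pfaffian {..<n} E \<longrightarrow>
      (\<forall>v<n. 3 \<le> degree E v) \<longrightarrow>
      hamiltonian_cycle {..<n} E hs \<longrightarrow>
      {a, b} \<in> cycle_edges hs \<longrightarrow>
      (\<exists>hs'. computes_in_linear_time c P (encode n es hs (a, b)) hs' \<and>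
             hamiltonian_cycle {..<n} E hs' \<and>
             cycle_edges hs' \<noteq> cycle_edges hs \<and>
             {a, b} \<in> cycle_edges hs')"
proof (rule exI[of _ "compile algorithm 0"], rule exI[of _ 200], intro allI impI)
  fix n :: nat and E :: "nat set set" and es :: "(nat \<times> nat) list" and hs :: "nat list"
    and a b :: nat
  assume G: "simple_graph {..<n} E" "edge_listing E es" "bipartite {..<n} E" "pfaffian {..<n} E"
    "\<forall>v<n. 3 \<le> degree E v" and ham: "hamiltonian_cycle {..<n} E hs" and ab: "{a, b} \<in> cycle_edges hs"
  obtain A where A: "pfaffian_orientation {..<n} E A" using G(4) by (auto simp: pfaffian_def)
  have hs: "distinct hs" "set hs = {..<n}" "3 \<le> length hs"
    using ham by (auto simp: hamiltonian_cycle_def is_cycle_def)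
  have len: "length hs = n" using distinct_card[OF hs(1)] hs(2) by simp
  have "a \<in> \<Union> (cycle_edges hs)" using ab by blast
  also have "\<Union> (cycle_edges hs) \<subseteq> set hs"
    using hs(3) by (force simp: cycle_edges_eq intro!: nth_mem mod_less_divisor)
  finally obtain q where q: "q < n" "hs ! q = a" using len by (auto simp: in_set_conv_nth)
  define ws where "ws = rotate q hs"
  have ws: "distinct ws" "length ws = n" "set ws = {..<n}" "cycle_edges ws = cycle_edges hs"
    using hs len by (simp_all add: ws_def cycle_edges_rotate)
  have ws_nth: "ws ! i = hs ! ((q + i) mod n)" if "i < n" for i
    using that len by (simp add: ws_def nth_rotate)
  have a0: "ws ! 0 = a" using ws_nth[of 0] q by simp
  have n3: "3 \<le> n" using hs(3) len by simp
  \<comment> \<open>The given cycle may traverse the anchor edge in either direction, so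
    \<open>b\<close> comes directly after \<open>a\<close> or is the last vertex.\<close>
  have "\<exists>pb. (pb = 1 \<or> pb = n - 1) \<and> ws ! pb = b"
  proof -
    obtain k where k: "k < n" "{a, b} = {ws ! k, ws ! (Suc k mod n)}"
      using ab ws(2) unfolding ws(4)[symmetric] by (auto simp: cycle_edges_eq)
    have l: "Suc k mod n < n" using n3 by (intro mod_less_divisor) simp
    consider "ws ! k = ws ! 0" "b = ws ! (Suc k mod n)" | "ws ! (Suc k mod n) = ws ! 0" "b = ws ! k"
      using k(2) a0 by (auto simp: doubleton_eq_iff)
    then show ?thesis
    proof cases
      case 1
      then have "k = 0" using ws(1,2) k(1) n3 by (simp add: nth_eq_iff_index_eq)
      then show ?thesis using 1 n3 by auto
    next
      case 2
      then have "Suc k mod n = 0" using ws(1,2) l n3 by (simp add: nth_eq_iff_index_eq)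
      then have "k = n - 1" using k(1) by (auto simp: mod_Suc split: if_splits)
      then show ?thesis using 2 by auto
    qed
  qed
  then obtain pb where pb: "pb = 1 \<or> pb = n - 1" "ws ! pb = b" by blast
  interpret ram_input "{..<n}" E A ws es hs a b q pb "if 1 < pb then 1 else n - 1"
      "5 * (4 + n + 2 * length es)"
  proof unfold_locales
    show "hamiltonian_cycle {..<n} E ws"
      using ham ws len hs(3) by (simp add: hamiltonian_cycle_def is_cycle_def)
  qed (use G A ws hs len q ws_nth a0 pb in auto)
  show "\<exists>hs'. computes_in_linear_time 200 (compile algorithm 0) (encode n es hs (a, b)) hs' \<and>
      hamiltonian_cycle {..<n} E hs' \<and> cycle_edges hs' \<noteq> cycle_edges hs \<and> {a, b} \<in> cycle_edges hs'"
    using computes_algorithm ws(2,4) by simp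
qed

end
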